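(* Let $R$ be a reduced commutative ring with identity having exactly $n$ minimal prime ideals, where $n\geq 3$ is an integer, and suppose that $\omega(\Gamma_{reg}(R))<\infty$. Let $T(R)$ be the total ring of fractions of $R$. Then: (i) $\omega(\Gamma_{reg}(R))=\chi(\Gamma_{reg}(R))=\chi(\Gamma_{reg}(T(R)))=\omega(\Gamma_{reg}(T(R)))=n-1$. (ii) $\chi'(\Gamma_{reg}(R))=\chi'(\Gamma_{reg}(T(R)))=2^{n-1}-2$.
   Context: $R$ is reduced if it has no non-zero nilpotent element. $T(R)$ is the localization of $R$ at the multiplicative set $R\setminus Z(R)$, where $Z(R)$ is the set of zero-divisors of $R$. An ideal is non-trivial if it is neither $(0)$ nor the whole ring. For a commutative ring $A$ with identity and an ideal $J$ of $A$, an element $x\in A$ is called $J$-regular if it is not a zero-divisor on $J$, i.e. $xy\neq 0$ for every $0\neq y\in J$. The regular graph of ideals $\Gamma_{reg}(A)$ is the simple undirected graph whose vertices are the non-trivial ideals of $A$, two distinct vertices $I,J$ being adjacent if and only if $I$ contains a $J$-regular element or $J$ contains an $I$-regular element. For a graph $G$, $\omega(G)$ is the clique number, $\chi(G)$ the vertex chromatic number and $\chi'(G)$ the edge chromatic number. *)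

theory Defs
  imports "HOL-Algebra.Ideal" "HOL-Library.Ramsey" "HOL-Library.Extended_Nat"
begin

section \<open>Simple graphs\<close>

text \<open>
  A simple graph is a pair of a (possibly infinite) vertex set and a set of two-element sets of
  vertices. Its parameters live in \<^typ>\<open>enat\<close>: a graph with arbitrarily large finite cliques has
  clique number \<open>\<infinity>\<close>, and the chromatic numbers are \<open>\<infinity>\<close> if no finite number of colours is enough.
\<close>

type_synonym 'v sgraph = "'v set \<times> 'v set set"

definition clique_number :: "'v sgraph \<Rightarrow> enat" where
  "clique_number G = (SUP K\<in>{K. K \<subseteq> fst G \<and> finite K \<and> clique K (snd G)}. enat (card K))"

definition proper_vertex_colouring :: "'v sgraph \<Rightarrow> nat \<Rightarrow> ('v \<Rightarrow> nat) \<Rightarrow> bool" where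
  "proper_vertex_colouring G k c \<longleftrightarrow>
     c ` fst G \<subseteq> {..<k} \<and> (\<forall>u\<in>fst G. \<forall>v\<in>fst G. {u, v} \<in> snd G \<longrightarrow> c u \<noteq> c v)"

definition chromatic_number :: "'v sgraph \<Rightarrow> enat" where
  "chromatic_number G = (INF k\<in>{k. \<exists>c. proper_vertex_colouring G k c}. enat k)"

definition proper_edge_colouring :: "'v sgraph \<Rightarrow> nat \<Rightarrow> ('v set \<Rightarrow> nat) \<Rightarrow> bool" where
  "proper_edge_colouring G k c \<longleftrightarrow>
     c ` snd G \<subseteq> {..<k} \<and>
     (\<forall>e\<in>snd G. \<forall>f\<in>snd G. e \<noteq> f \<and> e \<inter> f \<noteq> {} \<longrightarrow> c e \<noteq> c f)"

definition edge_chromatic_number :: "'v sgraph \<Rightarrow> enat" where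
  "edge_chromatic_number G = (INF k\<in>{k. \<exists>c. proper_edge_colouring G k c}. enat k)"

section \<open>Commutative rings\<close>

definition reduced_ring :: "('a, 'b) ring_scheme \<Rightarrow> bool" where
  "reduced_ring R \<longleftrightarrow>
     (\<forall>x\<in>carrier R. (\<exists>k::nat. k > 0 \<and> x [^]\<^bsub>R\<^esub> k = \<zero>\<^bsub>R\<^esub>) \<longrightarrow> x = \<zero>\<^bsub>R\<^esub>)"

definition minimal_primes :: "('a, 'b) ring_scheme \<Rightarrow> 'a set set" where
  "minimal_primes R = {P. primeideal P R \<and> (\<forall>Q. primeideal Q R \<and> Q \<subseteq> P \<longrightarrow> Q = P)}"

text \<open>In a non-zero ring, \<open>\<zero>\<close> counts as a zero-divisor.\<close>

definition zero_divisors :: "('a, 'b) ring_scheme \<Rightarrow> 'a set" where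
  "zero_divisors R =
     {x \<in> carrier R. \<exists>y\<in>carrier R. y \<noteq> \<zero>\<^bsub>R\<^esub> \<and> x \<otimes>\<^bsub>R\<^esub> y = \<zero>\<^bsub>R\<^esub>}"

definition nontrivial_ideals :: "('a, 'b) ring_scheme \<Rightarrow> 'a set set" where
  "nontrivial_ideals R = {I. ideal I R \<and> I \<noteq> {\<zero>\<^bsub>R\<^esub>} \<and> I \<noteq> carrier R}"

definition ideal_regular :: "('a, 'b) ring_scheme \<Rightarrow> 'a set \<Rightarrow> 'a \<Rightarrow> bool" where
  "ideal_regular R J x \<longleftrightarrow>
     x \<in> carrier R \<and> (\<forall>y\<in>J. y \<noteq> \<zero>\<^bsub>R\<^esub> \<longrightarrow> x \<otimes>\<^bsub>R\<^esub> y \<noteq> \<zero>\<^bsub>R\<^esub>)"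

definition regular_ideal_graph :: "('a, 'b) ring_scheme \<Rightarrow> 'a set sgraph" where
  "regular_ideal_graph R =
     (nontrivial_ideals R,
      {{I, J} | I J. I \<in> nontrivial_ideals R \<and> J \<in> nontrivial_ideals R \<and> I \<noteq> J \<and>
         ((\<exists>x\<in>I. ideal_regular R J x) \<or> (\<exists>x\<in>J. ideal_regular R I x))})"

section \<open>Localization\<close>

text \<open>
  For a multiplicatively closed set \<open>S\<close>, \<open>frac_class R S r s\<close> is the fraction \<open>r / s\<close>, as an equivalence
  class of pairs. The operations take unions over all representatives; each such union is over
  equal sets, as the lemmas \<open>frac_mult\<close> and \<open>frac_add\<close> show.
\<close>

definition frac_rel :: "('a, 'b) ring_scheme \<Rightarrow> 'a set \<Rightarrow> (('a \<times> 'a) \<times> ('a \<times> 'a)) set" where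
  "frac_rel R S =
     {((r, s), (r', s')). r \<in> carrier R \<and> s \<in> S \<and> r' \<in> carrier R \<and> s' \<in> S \<and>
        (\<exists>t\<in>S. t \<otimes>\<^bsub>R\<^esub> (r \<otimes>\<^bsub>R\<^esub> s') = t \<otimes>\<^bsub>R\<^esub> (r' \<otimes>\<^bsub>R\<^esub> s))}"

definition frac_class :: "('a, 'b) ring_scheme \<Rightarrow> 'a set \<Rightarrow> 'a \<Rightarrow> 'a \<Rightarrow> ('a \<times> 'a) set" where
  "frac_class R S r s = frac_rel R S `` {(r, s)}"

definition localization :: "('a, 'b) ring_scheme \<Rightarrow> 'a set \<Rightarrow> ('a \<times> 'a) set ring" where
  "localization R S =
     \<lparr>carrier = (carrier R \<times> S) // frac_rel R S,
      monoid.mult = (\<lambda>X Y. \<Union>(r, s)\<in>X. \<Union>(r', s')\<in>Y. frac_class R S (r \<otimes>\<^bsub>R\<^esub> r') (s \<otimes>\<^bsub>R\<^esub> s')),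
      one = frac_class R S \<one>\<^bsub>R\<^esub> \<one>\<^bsub>R\<^esub>,
      zero = frac_class R S \<zero>\<^bsub>R\<^esub> \<one>\<^bsub>R\<^esub>,
      add = (\<lambda>X Y. \<Union>(r, s)\<in>X. \<Union>(r', s')\<in>Y.
               frac_class R S (r \<otimes>\<^bsub>R\<^esub> s' \<oplus>\<^bsub>R\<^esub> r' \<otimes>\<^bsub>R\<^esub> s) (s \<otimes>\<^bsub>R\<^esub> s'))\<rparr>"

definition total_fraction_ring :: "('a, 'b) ring_scheme \<Rightarrow> ('a \<times> 'a) set ring" where
  "total_fraction_ring R = localization R (carrier R - zero_divisors R)"

lemma submonoid_non_zero_divisors:
  assumes "cring R"
  shows "submonoid (carrier R - zero_divisors R) R"
proof -
  interpret cring R by fact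
  show ?thesis
    by unfold_locales (auto simp: zero_divisors_def m_assoc)
qed

locale ring_localization = cring R + submonoid S R for R (structure) and S
begin

lemma frac_denom_carrier [simp]: "s \<in> S \<Longrightarrow> s \<in> carrier R"
  using subset by blast

lemma equiv_frac_rel: "equiv (carrier R \<times> S) (frac_rel R S)"
proof (rule equivI)
  show "frac_rel R S \<subseteq> (carrier R \<times> S) \<times> (carrier R \<times> S)"
    by (auto simp: frac_rel_def)
  show "refl_on (carrier R \<times> S) (frac_rel R S)"
    by (auto simp: frac_rel_def refl_on_def)
  show "sym (frac_rel R S)"
  proof (rule symI)
    fix p q assume "(p, q) \<in> frac_rel R S"
    then show "(q, p) \<in> frac_rel R S"
      unfolding frac_rel_def by clarsimp (metis (no_types))
  qed
  show "trans (frac_rel R S)"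
  proof (rule transI)
    fix p q w assume "(p, q) \<in> frac_rel R S" "(q, w) \<in> frac_rel R S"
    then obtain a s b u c v t t' where
      eq: "p = (a, s)" "q = (b, u)" "w = (c, v)" and
      ring_mem: "a \<in> carrier R" "b \<in> carrier R" "c \<in> carrier R" and
      S_mem: "s \<in> S" "u \<in> S" "v \<in> S" "t \<in> S" "t' \<in> S" and
      h: "t \<otimes> (a \<otimes> u) = t \<otimes> (b \<otimes> s)" "t' \<otimes> (b \<otimes> v) = t' \<otimes> (c \<otimes> u)"
      unfolding frac_rel_def by auto
    note S_carr = S_mem[THEN frac_denom_carrier]
    have "(t \<otimes> t' \<otimes> u) \<otimes> (a \<otimes> v) = (t \<otimes> (a \<otimes> u)) \<otimes> (t' \<otimes> v)"
      using ring_mem S_carr by (simp add: m_ac)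
    also have "\<dots> = (t' \<otimes> (b \<otimes> v)) \<otimes> (t \<otimes> s)"
      unfolding h(1) using ring_mem S_carr by (simp add: m_ac)
    also have "\<dots> = (t \<otimes> t' \<otimes> u) \<otimes> (c \<otimes> s)"
      unfolding h(2) using ring_mem S_carr by (simp add: m_ac)
    finally show "(p, w) \<in> frac_rel R S"
      unfolding frac_rel_def eq using ring_mem S_mem by auto
  qed
qed

lemma frac_eq_iff:
  assumes "r \<in> carrier R" "s \<in> S" "r' \<in> carrier R" "s' \<in> S"
  shows "frac_class R S r s = frac_class R S r' s' \<longleftrightarrow> (\<exists>t\<in>S. t \<otimes> (r \<otimes> s') = t \<otimes> (r' \<otimes> s))"
proof -
  have "frac_class R S r s = frac_class R S r' s' \<longleftrightarrow> ((r, s), (r', s')) \<in> frac_rel R S"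
    unfolding frac_class_def using assms by (intro eq_equiv_class_iff[OF equiv_frac_rel]) auto
  then show ?thesis
    using assms by (simp add: frac_rel_def)
qed

lemma frac_eqI:
  assumes "r \<in> carrier R" "s \<in> S" "r' \<in> carrier R" "s' \<in> S" "r \<otimes> s' = r' \<otimes> s"
  shows "frac_class R S r s = frac_class R S r' s'"
  unfolding frac_eq_iff[OF assms(1-4)] by (rule bexI[of _ \<one>]) (simp_all add: assms(5))

lemma frac_eqI':
  assumes "t \<otimes> (r \<otimes> s') = t \<otimes> (r' \<otimes> s)"
    and "t \<in> S" "r \<in> carrier R" "s \<in> S" "r' \<in> carrier R" "s' \<in> S"
  shows "frac_class R S r s = frac_class R S r' s'"
  unfolding frac_eq_iff[OF assms(3-6)] by (rule bexI) fact+

lemma frac_closed: "r \<in> carrier R \<Longrightarrow> s \<in> S \<Longrightarrow> frac_class R S r s \<in> carrier (localization R S)"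
  by (auto simp: localization_def frac_class_def intro: quotientI)

lemma frac_cases:
  assumes "X \<in> carrier (localization R S)"
  obtains r s where "r \<in> carrier R" "s \<in> S" "X = frac_class R S r s"
  using assms by (auto simp: localization_def frac_class_def elim: quotientE)

lemma frac_Union2:
  assumes "r \<in> carrier R" "s \<in> S" "r' \<in> carrier R" "s' \<in> S"
    and "\<And>a u b v t t'. \<lbrakk>a \<in> carrier R; b \<in> carrier R; u \<in> S; v \<in> S; t \<in> S; t' \<in> S;
           t \<otimes> (r \<otimes> u) = t \<otimes> (a \<otimes> s); t' \<otimes> (r' \<otimes> v) = t' \<otimes> (b \<otimes> s')\<rbrakk>
         \<Longrightarrow> F a u b v = F r s r' s'"
  shows "(\<Union>(a, u)\<in>frac_class R S r s. \<Union>(b, v)\<in>frac_class R S r' s'. F a u b v) = F r s r' s'"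
proof -
  have mem: "(r, s) \<in> frac_class R S r s" "(r', s') \<in> frac_class R S r' s'"
    using assms(1-4) by (auto simp: frac_class_def frac_rel_def)
  have eq: "F a u b v = F r s r' s'"
    if "(a, u) \<in> frac_class R S r s" "(b, v) \<in> frac_class R S r' s'" for a u b v
  proof -
    from that obtain t t' where
      "a \<in> carrier R" "b \<in> carrier R" "u \<in> S" "v \<in> S" "t \<in> S" "t' \<in> S"
      "t \<otimes> (r \<otimes> u) = t \<otimes> (a \<otimes> s)" "t' \<otimes> (r' \<otimes> v) = t' \<otimes> (b \<otimes> s')"
      unfolding frac_class_def frac_rel_def by blast
    then show ?thesis
      by (rule assms(5))
  qed
  have inner: "(\<Union>(b, v)\<in>frac_class R S r' s'. F a u b v) = F r s r' s'" if "(a, u) \<in> frac_class R S r s" for a u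
    by (rule UN_constant_eq[OF mem(2)]) (use eq[OF that] in auto)
  show ?thesis
    by (rule UN_constant_eq[OF mem(1)]) (use inner in auto)
qed

lemma frac_mult:
  assumes "r \<in> carrier R" "s \<in> S" "r' \<in> carrier R" "s' \<in> S"
  shows "frac_class R S r s \<otimes>\<^bsub>localization R S\<^esub> frac_class R S r' s' = frac_class R S (r \<otimes> r') (s \<otimes> s')"
  unfolding localization_def monoid.simps
proof (rule frac_Union2[OF assms, of
    "\<lambda>a u b v. frac_class R S (a \<otimes> b) (u \<otimes> v)"])
  fix a u b v t t'
  assume mem: "a \<in> carrier R" "b \<in> carrier R" "u \<in> S" "v \<in> S" "t \<in> S" "t' \<in> S"
    and h: "t \<otimes> (r \<otimes> u) = t \<otimes> (a \<otimes> s)" "t' \<otimes> (r' \<otimes> v) = t' \<otimes> (b \<otimes> s')"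
  note carr = mem(1,2) mem(3-6)[THEN frac_denom_carrier] assms(1,3) assms(2,4)[THEN frac_denom_carrier]
  have "(t \<otimes> t') \<otimes> ((a \<otimes> b) \<otimes> (s \<otimes> s')) = (t \<otimes> (a \<otimes> s)) \<otimes> (t' \<otimes> (b \<otimes> s'))"
    using carr by (simp add: m_ac)
  also have "\<dots> = (t \<otimes> t') \<otimes> ((r \<otimes> r') \<otimes> (u \<otimes> v))"
    unfolding h[symmetric] using carr by (simp add: m_ac)
  finally show "frac_class R S (a \<otimes> b) (u \<otimes> v) = frac_class R S (r \<otimes> r') (s \<otimes> s')"
    by (rule frac_eqI') (simp_all add: mem assms)
qed

lemma frac_add:
  assumes "r \<in> carrier R" "s \<in> S" "r' \<in> carrier R" "s' \<in> S"
  shows "frac_class R S r s \<oplus>\<^bsub>localization R S\<^esub> frac_class R S r' s' =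
           frac_class R S (r \<otimes> s' \<oplus> r' \<otimes> s) (s \<otimes> s')"
  unfolding localization_def ring.simps
proof (rule frac_Union2[OF assms, of
    "\<lambda>a u b v. frac_class R S (a \<otimes> v \<oplus> b \<otimes> u) (u \<otimes> v)"])
  fix a u b v t t'
  assume mem: "a \<in> carrier R" "b \<in> carrier R" "u \<in> S" "v \<in> S" "t \<in> S" "t' \<in> S"
    and h: "t \<otimes> (r \<otimes> u) = t \<otimes> (a \<otimes> s)" "t' \<otimes> (r' \<otimes> v) = t' \<otimes> (b \<otimes> s')"
  note carr = mem(1,2) mem(3-6)[THEN frac_denom_carrier] assms(1,3) assms(2,4)[THEN frac_denom_carrier]
  have e1: "(t \<otimes> t') \<otimes> ((a \<otimes> v) \<otimes> (s \<otimes> s')) = (t \<otimes> t') \<otimes> ((r \<otimes> s') \<otimes> (u \<otimes> v))"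
  proof -
    have "(t \<otimes> t') \<otimes> ((a \<otimes> v) \<otimes> (s \<otimes> s')) = (t \<otimes> (a \<otimes> s)) \<otimes> (t' \<otimes> (v \<otimes> s'))"
      using carr by (simp add: m_ac)
    also have "\<dots> = (t \<otimes> t') \<otimes> ((r \<otimes> s') \<otimes> (u \<otimes> v))"
      unfolding h[symmetric] using carr by (simp add: m_ac)
    finally show ?thesis .
  qed
  have e2: "(t \<otimes> t') \<otimes> ((b \<otimes> u) \<otimes> (s \<otimes> s')) = (t \<otimes> t') \<otimes> ((r' \<otimes> s) \<otimes> (u \<otimes> v))"
  proof -
    have "(t \<otimes> t') \<otimes> ((b \<otimes> u) \<otimes> (s \<otimes> s')) = (t' \<otimes> (b \<otimes> s')) \<otimes> (t \<otimes> (u \<otimes> s))"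
      using carr by (simp add: m_ac)
    also have "\<dots> = (t \<otimes> t') \<otimes> ((r' \<otimes> s) \<otimes> (u \<otimes> v))"
      unfolding h[symmetric] using carr by (simp add: m_ac)
    finally show ?thesis .
  qed
  have "(t \<otimes> t') \<otimes> ((a \<otimes> v \<oplus> b \<otimes> u) \<otimes> (s \<otimes> s')) =
      (t \<otimes> t') \<otimes> ((r \<otimes> s' \<oplus> r' \<otimes> s) \<otimes> (u \<otimes> v))"
    using carr by (simp add: l_distr r_distr e1 e2)
  then show "frac_class R S (a \<otimes> v \<oplus> b \<otimes> u) (u \<otimes> v) = frac_class R S (r \<otimes> s' \<oplus> r' \<otimes> s) (s \<otimes> s')"
    by (rule frac_eqI') (simp_all add: mem assms)
qed

lemma localization_one: "\<one>\<^bsub>localization R S\<^esub> = frac_class R S \<one> \<one>"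
  and localization_zero: "\<zero>\<^bsub>localization R S\<^esub> = frac_class R S \<zero> \<one>"
  by (simp_all add: localization_def)

theorem localization_cring: "cring (localization R S)"
proof (rule cringI)
  let ?L = "localization R S"
  note ops = frac_mult frac_add localization_one localization_zero
  show "abelian_group ?L"
  proof (rule abelian_groupI)
    fix X Y assume "X \<in> carrier ?L" "Y \<in> carrier ?L"
    then show "X \<oplus>\<^bsub>?L\<^esub> Y \<in> carrier ?L"
      by (elim frac_cases) (auto simp: ops intro!: frac_closed)
  next
    show "\<zero>\<^bsub>?L\<^esub> \<in> carrier ?L"
      by (auto simp: ops intro!: frac_closed)
  next
    fix X Y Z assume "X \<in> carrier ?L" "Y \<in> carrier ?L" "Z \<in> carrier ?L"
    then show "X \<oplus>\<^bsub>?L\<^esub> Y \<oplus>\<^bsub>?L\<^esub> Z = X \<oplus>\<^bsub>?L\<^esub> (Y \<oplus>\<^bsub>?L\<^esub> Z)"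
      by (elim frac_cases) (simp add: ops, intro frac_eqI; simp add: l_distr r_distr; simp add: m_ac a_ac)
  next
    fix X Y assume "X \<in> carrier ?L" "Y \<in> carrier ?L"
    then show "X \<oplus>\<^bsub>?L\<^esub> Y = Y \<oplus>\<^bsub>?L\<^esub> X"
      by (elim frac_cases) (simp add: ops, intro frac_eqI; simp add: l_distr r_distr; simp add: m_ac a_ac)
  next
    fix X assume "X \<in> carrier ?L"
    then show "\<zero>\<^bsub>?L\<^esub> \<oplus>\<^bsub>?L\<^esub> X = X"
      by (elim frac_cases) (simp add: ops)
  next
    fix X assume "X \<in> carrier ?L"
    then obtain r s where X: "r \<in> carrier R" "s \<in> S" "X = frac_class R S r s"
      by (elim frac_cases)
    have "frac_class R S (\<ominus> r) s \<oplus>\<^bsub>?L\<^esub> X = \<zero>\<^bsub>?L\<^esub>"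
      using X by (simp add: ops, intro frac_eqI; simp add: l_minus l_neg)
    then show "\<exists>Y\<in>carrier ?L. Y \<oplus>\<^bsub>?L\<^esub> X = \<zero>\<^bsub>?L\<^esub>"
      using X by (intro bexI[of _ "frac_class R S (\<ominus> r) s"] frac_closed) auto
  qed
  show "Group.comm_monoid ?L"
  proof (rule comm_monoidI)
    fix X Y assume "X \<in> carrier ?L" "Y \<in> carrier ?L"
    then show "X \<otimes>\<^bsub>?L\<^esub> Y \<in> carrier ?L"
      by (elim frac_cases) (auto simp: ops intro!: frac_closed)
  next
    show "\<one>\<^bsub>?L\<^esub> \<in> carrier ?L"
      by (auto simp: ops intro!: frac_closed)
  next
    fix X Y Z assume "X \<in> carrier ?L" "Y \<in> carrier ?L" "Z \<in> carrier ?L"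
    then show "X \<otimes>\<^bsub>?L\<^esub> Y \<otimes>\<^bsub>?L\<^esub> Z = X \<otimes>\<^bsub>?L\<^esub> (Y \<otimes>\<^bsub>?L\<^esub> Z)"
      by (elim frac_cases) (simp add: ops m_assoc)
  next
    fix X assume "X \<in> carrier ?L"
    then show "\<one>\<^bsub>?L\<^esub> \<otimes>\<^bsub>?L\<^esub> X = X"
      by (elim frac_cases) (simp add: ops)
  next
    fix X Y assume "X \<in> carrier ?L" "Y \<in> carrier ?L"
    then show "X \<otimes>\<^bsub>?L\<^esub> Y = Y \<otimes>\<^bsub>?L\<^esub> X"
      by (elim frac_cases) (simp add: ops m_comm)
  qed
  fix X Y Z assume "X \<in> carrier ?L" "Y \<in> carrier ?L" "Z \<in> carrier ?L"
  then show "(X \<oplus>\<^bsub>?L\<^esub> Y) \<otimes>\<^bsub>?L\<^esub> Z = X \<otimes>\<^bsub>?L\<^esub> Z \<oplus>\<^bsub>?L\<^esub> Y \<otimes>\<^bsub>?L\<^esub> Z"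
    by (elim frac_cases) (simp add: ops, intro frac_eqI; simp add: l_distr r_distr; simp add: m_ac a_ac)
qed

end

corollary total_fraction_ring_cring:
  assumes "cring R"
  shows "cring (total_fraction_ring R)"
proof -
  have "ring_localization R (carrier R - zero_divisors R)"
    using assms submonoid_non_zero_divisors by (simp add: ring_localization_def)
  then show ?thesis
    unfolding total_fraction_ring_def by (rule ring_localization.localization_cring)
qed

end

theory Submission
  imports Defs "HOL-Algebra.QuotRing"
begin

text \<open>
  If a non-zero-divisor \<open>x\<close> were not a unit, the ideals \<open>(x), (x\<^sup>2), (x\<^sup>3), \<dots>\<close> would be pairwise distinct, and
  each of them would contain an element that is regular on every ideal; they would form an infinite
  clique. So a finite clique number makes every non-zero-divisor invertible
  (\<open>regular_elem_unit_if_finite_clique_number\<close>). Then \<open>R\<close> is isomorphic to its total ring of fractions,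
  and only the graph of \<open>R\<close> is left to be studied.

  In a reduced ring the minimal primes intersect in \<open>0\<close> (\<open>exists_minimal_prime_avoiding\<close>), hence an
  element outside all of them is a non-zero-divisor, here a unit. Since there are finitely many minimal
  primes, this makes an ideal \<open>J\<close> determined by its locus, the set of minimal primes that do not
  contain \<open>J\<close>; every set of minimal primes is a locus, and \<open>J\<close> contains a \<open>K\<close>-regular element iff
  the locus of \<open>J\<close> contains that of \<open>K\<close>. The ring is a product of \<open>n\<close> fields, but the argument
  uses loci directly and never forms the product. The conclusion
  (\<open>regular_ideal_graph_iso_subset_graph\<close>) is that the graph of \<open>R\<close> is the comparability graph of the
  proper non-empty subsets of an \<open>n\<close>-element set.

  The rest is combinatorics of this comparability graph. Its cliques are chains, and the cardinality
  is a proper vertex colouring, so the clique and chromatic numbers are both \<open>n - 1\<close>. A singleton has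
  \<open>2\<^sup>n\<^sup>-\<^sup>1 - 2\<close> neighbours, which bounds the edge chromatic number from below. For the upper bound one
  needs an edge colouring with exactly that many colours. Put \<open>m = n - 1\<close> and take the vertices to be
  the subsets of \<open>{0, \<dots>, m}\<close>. A proper non-empty subset \<open>X\<close> determines the split of \<open>{0, \<dots>, m}\<close> into
  \<open>X\<close> and its complement, and the part of the split that avoids the point \<open>m\<close> is a non-empty subset of
  \<open>M = {0, \<dots>, m - 1}\<close>. Comparable sets give two distinct non-empty subsets of \<open>M\<close> that are nested or
  disjoint, and distinct neighbours of a vertex give distinct subsets. It is therefore enough to
  colour the edges of the laminar graph, which joins nested and disjoint subsets of \<open>M\<close>. There the
  symmetric difference is a proper edge colouring whose colours are the \<open>2\<^sup>m - 1\<close> non-empty subsets of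
  \<open>M\<close>: one colour too many. The superfluous colour \<open>M\<close> is that of the edges between \<open>X\<close> and \<open>M - X\<close>. For
  \<open>m \<ge> 4\<close> these edges, and \<open>2m\<close> further ones, can be recoloured within the remaining colours
  (\<open>laminar_pair_colouring\<close>). For \<open>m = 3\<close> a table does it; for \<open>m = 2\<close> the laminar graph is a triangle,
  which does need three colours, but the comparability graph itself is a hexagon, which needs two.
\<close>

section \<open>Graph isomorphisms and the invariants of a graph\<close>

definition graph_embedding :: "('u \<Rightarrow> 'v) \<Rightarrow> 'u sgraph \<Rightarrow> 'v sgraph \<Rightarrow> bool" where
  "graph_embedding f G H \<longleftrightarrow>
     inj_on f (fst G) \<and> f ` fst G \<subseteq> fst H \<and> \<Union>(snd G) \<subseteq> fst G \<and> (`) f ` snd G \<subseteq> snd H"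

definition graph_iso :: "('u \<Rightarrow> 'v) \<Rightarrow> 'u sgraph \<Rightarrow> 'v sgraph \<Rightarrow> bool" where
  "graph_iso f G H \<longleftrightarrow> bij_betw f (fst G) (fst H) \<and> \<Union>(snd G) \<subseteq> fst G \<and> (`) f ` snd G = snd H"

lemma clique_number_geI:
  assumes "K \<subseteq> fst G" "finite K" "clique K (snd G)"
  shows "enat (card K) \<le> clique_number G"
  unfolding clique_number_def using assms by (intro SUP_upper) auto

lemma clique_number_leI:
  assumes "\<And>K. \<lbrakk>K \<subseteq> fst G; finite K; clique K (snd G)\<rbrakk> \<Longrightarrow> enat (card K) \<le> k"
  shows "clique_number G \<le> k"
  unfolding clique_number_def using assms by (intro SUP_least) auto

lemma chromatic_number_leI: "proper_vertex_colouring G k c \<Longrightarrow> chromatic_number G \<le> enat k"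
  unfolding chromatic_number_def by (intro INF_lower) auto

lemma edge_chromatic_number_leI: "proper_edge_colouring G k c \<Longrightarrow> edge_chromatic_number G \<le> enat k"
  unfolding edge_chromatic_number_def by (intro INF_lower) auto

lemma clique_number_embedding:
  assumes "graph_embedding f G H"
  shows "clique_number G \<le> clique_number H"
proof (rule clique_number_leI)
  fix K assume K: "K \<subseteq> fst G" "finite K" "clique K (snd G)"
  have inj: "inj_on f (fst G)" and edge: "(`) f ` snd G \<subseteq> snd H" and sub: "f ` fst G \<subseteq> fst H"
    using assms by (auto simp: graph_embedding_def)
  have "clique (f ` K) (snd H)"
    unfolding clique_def
  proof clarsimp
    fix u v assume "u \<in> K" "v \<in> K" "f u \<noteq> f v"
    then have "{u, v} \<in> snd G"
      using K(3) by (auto simp: clique_def)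
    then show "{f u, f v} \<in> snd H"
      using edge by (force simp: image_subset_iff dest: bspec)
  qed
  then have "enat (card (f ` K)) \<le> clique_number H"
    using K sub by (intro clique_number_geI) auto
  then show "enat (card K) \<le> clique_number H"
    using card_image[OF inj_on_subset[OF inj K(1)]] by simp
qed

lemma chromatic_number_embedding:
  assumes "graph_embedding f G H"
  shows "chromatic_number G \<le> chromatic_number H"
  unfolding chromatic_number_def[of H]
proof (rule INF_greatest)
  fix k assume "k \<in> {k. \<exists>c. proper_vertex_colouring H k c}"
  then obtain c where c: "proper_vertex_colouring H k c" by blast
  have edge: "(`) f ` snd G \<subseteq> snd H" and sub: "f ` fst G \<subseteq> fst H"
    using assms by (auto simp: graph_embedding_def)
  have "proper_vertex_colouring G k (c \<circ> f)"
    unfolding proper_vertex_colouring_def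
  proof (intro conjI ballI impI)
    show "(c \<circ> f) ` fst G \<subseteq> {..<k}"
      using c sub by (auto simp: proper_vertex_colouring_def)
    fix u v assume "u \<in> fst G" "v \<in> fst G" "{u, v} \<in> snd G"
    moreover from this have "{f u, f v} \<in> snd H"
      using edge by (force simp: image_subset_iff dest: bspec)
    ultimately show "(c \<circ> f) u \<noteq> (c \<circ> f) v"
      using c sub unfolding proper_vertex_colouring_def by (simp add: image_subset_iff)
  qed
  then show "chromatic_number G \<le> enat k"
    by (rule chromatic_number_leI)
qed

lemma edge_chromatic_number_embedding:
  assumes "graph_embedding f G H"
  shows "edge_chromatic_number G \<le> edge_chromatic_number H"
  unfolding edge_chromatic_number_def[of H]
proof (rule INF_greatest)
  fix k assume "k \<in> {k. \<exists>c. proper_edge_colouring H k c}"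
  then obtain c where c: "proper_edge_colouring H k c" by blast
  have inj: "inj_on f (fst G)" and edge: "\<And>e. e \<in> snd G \<Longrightarrow> f ` e \<in> snd H"
    and wf: "\<And>e. e \<in> snd G \<Longrightarrow> e \<subseteq> fst G"
    using assms by (auto simp: graph_embedding_def)
  have "proper_edge_colouring G k (\<lambda>e. c (f ` e))"
    unfolding proper_edge_colouring_def
  proof (intro conjI ballI impI)
    show "(\<lambda>e. c (f ` e)) ` snd G \<subseteq> {..<k}"
      using c edge by (auto simp: proper_edge_colouring_def)
    fix d e assume de: "d \<in> snd G" "e \<in> snd G" "d \<noteq> e \<and> d \<inter> e \<noteq> {}"
    then have "f ` d \<noteq> f ` e" "f ` d \<inter> f ` e \<noteq> {}"
      using inj_on_image_eq_iff[OF inj wf wf] by auto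
    with de show "c (f ` d) \<noteq> c (f ` e)"
      using c edge by (auto simp: proper_edge_colouring_def)
  qed
  then show "edge_chromatic_number G \<le> enat k"
    by (rule edge_chromatic_number_leI)
qed

lemma graph_iso_embeddings:
  assumes "graph_iso f G H"
  shows "graph_embedding f G H" "graph_embedding (inv_into (fst G) f) H G"
proof -
  let ?g = "inv_into (fst G) f"
  have f: "inj_on f (fst G)" "f ` fst G = fst H" "(`) f ` snd G = snd H"
    and wf: "\<And>e. e \<in> snd G \<Longrightarrow> e \<subseteq> fst G"
    using assms by (auto simp: graph_iso_def bij_betw_def)
  then show "graph_embedding f G H"
    using assms by (auto simp: graph_embedding_def graph_iso_def)
  have "?g ` (f ` e) = e" if "e \<in> snd G" for e
    using inv_into_image_cancel[OF f(1) wf[OF that]] .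
  then have "(`) ?g ` snd H \<subseteq> snd G"
    unfolding f(3)[symmetric] by (simp add: image_subset_iff)
  moreover have "\<Union>(snd H) \<subseteq> fst H"
    unfolding f(2,3)[symmetric] using wf by auto
  moreover have "inj_on ?g (fst H)" "?g ` fst H \<subseteq> fst G"
    using f(2) by (auto simp: inj_on_inv_into inv_into_into)
  ultimately show "graph_embedding ?g H G"
    by (simp add: graph_embedding_def)
qed

lemma graph_iso_invariants:
  assumes "graph_iso f G H"
  shows "clique_number G = clique_number H"
    and "chromatic_number G = chromatic_number H"
    and "edge_chromatic_number G = edge_chromatic_number H"
  using graph_iso_embeddings[OF assms]
  by (meson antisym clique_number_embedding chromatic_number_embedding
        edge_chromatic_number_embedding)+

lemma clique_number_le_chromatic_number: "clique_number G \<le> chromatic_number G"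
proof (rule clique_number_leI)
  fix K assume K: "K \<subseteq> fst G" "finite K" "clique K (snd G)"
  show "enat (card K) \<le> chromatic_number G"
    unfolding chromatic_number_def
  proof (rule INF_greatest)
    fix k assume "k \<in> {k. \<exists>c. proper_vertex_colouring G k c}"
    then obtain c where c: "proper_vertex_colouring G k c" by blast
    have "inj_on c K"
    proof (rule inj_onI, rule ccontr)
      fix u v assume "u \<in> K" "v \<in> K" "c u = c v" "u \<noteq> v"
      moreover from this have "{u, v} \<in> snd G"
        using K(3) by (auto simp: clique_def)
      ultimately show False
        using c K(1) unfolding proper_vertex_colouring_def by blast
    qed
    moreover have "c ` K \<subseteq> {..<k}"
      using c K(1) by (auto simp: proper_vertex_colouring_def)
    ultimately have "card K \<le> card {..<k}"
      by (intro card_inj_on_le) auto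
    then show "enat (card K) \<le> enat k" by simp
  qed
qed

lemma proper_edge_colouringD:
  "\<lbrakk>proper_edge_colouring G k c; d \<noteq> e; d \<in> snd G; e \<in> snd G; v \<in> d; v \<in> e\<rbrakk> \<Longrightarrow> c d \<noteq> c e"
  unfolding proper_edge_colouring_def by (metis IntI empty_iff)

text \<open>
  The colours of the edges from one vertex to \<open>N\<close> are pairwise distinct.
\<close>

lemma degree_le_edge_chromatic_number:
  assumes "\<And>w. w \<in> N \<Longrightarrow> w \<noteq> v \<and> {v, w} \<in> snd G"
  shows "enat (card N) \<le> edge_chromatic_number G"
  unfolding edge_chromatic_number_def
proof (rule INF_greatest)
  fix k assume "k \<in> {k. \<exists>c. proper_edge_colouring G k c}"
  then obtain c where c: "proper_edge_colouring G k c" by blast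
  have "inj_on (\<lambda>w. c {v, w}) N"
  proof (rule inj_onI, rule ccontr)
    fix w w' assume *: "w \<in> N" "w' \<in> N" "c {v, w} = c {v, w'}" "w \<noteq> w'"
    then have "{v, w} \<noteq> {v, w'}"
      by (simp add: doubleton_eq_iff)
    moreover have "{v, w} \<in> snd G" "{v, w'} \<in> snd G"
      using assms[OF *(1)] assms[OF *(2)] by simp_all
    ultimately have "c {v, w} \<noteq> c {v, w'}"
      by (rule proper_edge_colouringD[OF c, where v = v]) simp_all
    then show False using *(3) by simp
  qed
  moreover have "(\<lambda>w. c {v, w}) ` N \<subseteq> {..<k}"
    using c assms by (simp add: proper_edge_colouring_def image_subset_iff)
  ultimately have "card N \<le> card {..<k}"
    by (intro card_inj_on_le) auto
  then show "enat (card N) \<le> enat k" by simp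
qed

section \<open>Edge colourings as functions of two vertices\<close>

text \<open>
  A colour that depends on the two ends of an edge is easier to write down than one that depends on
  the edge as a set; the symmetry condition makes the two views agree.
\<close>

definition pair_colouring :: "'v sgraph \<Rightarrow> 'c set \<Rightarrow> ('v \<Rightarrow> 'v \<Rightarrow> 'c) \<Rightarrow> bool" where
  "pair_colouring G C c \<longleftrightarrow>
     (\<forall>u v. {u, v} \<in> snd G \<longrightarrow> c u v \<in> C \<and> c u v = c v u) \<and>
     (\<forall>u v w. {u, v} \<in> snd G \<longrightarrow> {u, w} \<in> snd G \<longrightarrow> v \<noteq> w \<longrightarrow> c u v \<noteq> c u w)"

lemma edge_chromatic_number_le_pair_colouring:
  assumes c: "pair_colouring G C c" and "finite C" and edges: "\<And>e. e \<in> snd G \<Longrightarrow> \<exists>u v. e = {u, v}"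
  shows "edge_chromatic_number G \<le> enat (card C)"
proof -
  obtain b where b: "bij_betw b C {0..<card C}"
    using ex_bij_betw_finite_nat[OF \<open>finite C\<close>] by blast
  define s t where "s e = (SOME u. \<exists>v. e = {u, v})" and "t e = (SOME v. e = {s e, v})" for e :: "'a set"
  have st: "e = {s e, t e}" if "e \<in> snd G" for e
  proof -
    have "\<exists>v. e = {s e, v}"
      unfolding s_def by (rule someI_ex) (use edges[OF that] in blast)
    then show ?thesis
      unfolding t_def by (rule someI_ex)
  qed
  define d where "d e = c (s e) (t e)" for e
  have d: "d {u, v} = c u v" if "{u, v} \<in> snd G" for u v
  proof -
    have "(s {u, v} = u \<and> t {u, v} = v) \<or> (s {u, v} = v \<and> t {u, v} = u)"
      using st[OF that] by (metis doubleton_eq_iff)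
    moreover have "c u v = c v u"
      using c that unfolding pair_colouring_def by blast
    ultimately show ?thesis by (auto simp: d_def)
  qed
  have "proper_edge_colouring G (card C) (b \<circ> d)"
    unfolding proper_edge_colouring_def
  proof (intro conjI ballI impI)
    have dC: "d e \<in> C" if "e \<in> snd G" for e
      using c st[OF that] that unfolding pair_colouring_def d_def by metis
    then show "(b \<circ> d) ` snd G \<subseteq> {..<card C}"
      using b by (auto simp: bij_betw_def)
    fix e f assume ef: "e \<in> snd G" "f \<in> snd G" "e \<noteq> f \<and> e \<inter> f \<noteq> {}"
    then obtain u v w where uvw: "e = {u, v}" "f = {u, w}" "v \<noteq> w"
      using edges[OF ef(1)] edges[OF ef(2)] by (auto simp: insert_commute)
    then have "d e \<noteq> d f"
      using c ef d unfolding pair_colouring_def by metis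
    then show "(b \<circ> d) e \<noteq> (b \<circ> d) f"
      using b dC ef by (auto simp: bij_betw_def dest: inj_onD)
  qed
  then show ?thesis by (rule edge_chromatic_number_leI)
qed

text \<open>
  Two edges at \<open>u\<close> are mapped to two edges at \<open>f u\<close>, and local injectivity keeps them distinct. The
  map \<open>f\<close> may identify vertices as long as they have no common neighbour.
\<close>

lemma pair_colouring_pullback:
  assumes c: "pair_colouring H C c"
    and hom: "\<And>u v. {u, v} \<in> snd G \<Longrightarrow> {f u, f v} \<in> snd H"
    and loc_inj: "\<And>u v w. \<lbrakk>{u, v} \<in> snd G; {u, w} \<in> snd G; v \<noteq> w\<rbrakk> \<Longrightarrow> f v \<noteq> f w"
  shows "pair_colouring G C (\<lambda>u v. c (f u) (f v))"
  unfolding pair_colouring_def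
proof (intro conjI allI impI)
  fix u v assume "{u, v} \<in> snd G"
  then show "c (f u) (f v) \<in> C" "c (f u) (f v) = c (f v) (f u)"
    using c hom[of u v] by (auto simp: pair_colouring_def)
next
  fix u v w assume "{u, v} \<in> snd G" "{u, w} \<in> snd G" "v \<noteq> w"
  then show "c (f u) (f v) \<noteq> c (f u) (f w)"
    using c hom[of u v] hom[of u w] loc_inj[of u v w] unfolding pair_colouring_def by blast
qed

section \<open>The comparability graph of the proper non-empty subsets of a set\<close>

definition subset_graph :: "'a set \<Rightarrow> 'a set sgraph" where
  "subset_graph U =
     ({X. X \<subseteq> U \<and> X \<noteq> {} \<and> X \<noteq> U}, {{X, Y} | X Y. X \<noteq> {} \<and> X \<subset> Y \<and> Y \<subset> U})"

lemma subset_graph_edge_iff: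
  "{X, Y} \<in> snd (subset_graph U) \<longleftrightarrow>
     X \<noteq> {} \<and> Y \<noteq> {} \<and> X \<subset> U \<and> Y \<subset> U \<and> (X \<subset> Y \<or> Y \<subset> X)"
  by (auto simp: subset_graph_def doubleton_eq_iff)

lemma subset_graph_iso:
  assumes "bij_betw f U V"
  shows "graph_iso ((`) f) (subset_graph U) (subset_graph V)"
proof -
  have inj: "inj_on f U" and img: "f ` U = V"
    using assms by (auto simp: bij_betw_def)
  have eq: "f ` X = f ` Y \<longleftrightarrow> X = Y" if "X \<subseteq> U" "Y \<subseteq> U" for X Y
    using inj_on_image_eq_iff[OF inj that] .
  have strict: "f ` X \<subset> f ` Y \<longleftrightarrow> X \<subset> Y" if "X \<subseteq> U" "Y \<subseteq> U" for X Y
  proof -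
    have "f ` X \<subseteq> f ` Y \<longleftrightarrow> X \<subseteq> Y"
      using that inj_on_image_mem_iff[OF inj _ that(2)] by blast
    then show ?thesis
      using eq[OF that] by (simp add: psubset_eq)
  qed
  have surj: "\<exists>X\<subseteq>U. Y = f ` X" if "Y \<subseteq> V" for Y
    using that unfolding img[symmetric] by (meson subset_imageE)
  have "bij_betw ((`) f) (fst (subset_graph U)) (fst (subset_graph V))"
    unfolding bij_betw_def
  proof
    show "inj_on ((`) f) (fst (subset_graph U))"
      by (auto simp: subset_graph_def inj_on_def eq)
    show "(`) ((`) f) (fst (subset_graph U)) = fst (subset_graph V)"
    proof (intro subset_antisym subsetI)
      fix Y assume "Y \<in> (`) ((`) f) (fst (subset_graph U))"
      then obtain X where "Y = f ` X" "X \<subseteq> U" "X \<noteq> {}" "X \<noteq> U"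
        by (auto simp: subset_graph_def)
      then show "Y \<in> fst (subset_graph V)"
        using img eq[of X U] by (auto simp: subset_graph_def)
    next
      fix Y assume "Y \<in> fst (subset_graph V)"
      moreover from this obtain X where "X \<subseteq> U" "Y = f ` X"
        using surj[of Y] by (auto simp: subset_graph_def)
      ultimately show "Y \<in> (`) ((`) f) (fst (subset_graph U))"
        using img by (auto simp: subset_graph_def)
    qed
  qed
  moreover have "(`) ((`) f) ` snd (subset_graph U) = snd (subset_graph V)"
  proof (intro subset_antisym subsetI)
    fix e assume "e \<in> (`) ((`) f) ` snd (subset_graph U)"
    then obtain X Y where XY: "e = {f ` X, f ` Y}" "X \<noteq> {}" "X \<subset> Y" "Y \<subset> U"
      by (auto simp: subset_graph_def)
    then have "f ` X \<subset> f ` Y" "f ` Y \<subset> V"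
      using strict[of X Y] strict[of Y U] img by auto
    then show "e \<in> snd (subset_graph V)"
      using XY by (auto simp: subset_graph_edge_iff)
  next
    fix e assume "e \<in> snd (subset_graph V)"
    then obtain X' Y' where XY': "e = {X', Y'}" "X' \<noteq> {}" "X' \<subset> Y'" "Y' \<subset> V"
      by (auto simp: subset_graph_def)
    moreover from this have "X' \<subseteq> V" "Y' \<subseteq> V" by auto
    then obtain X Y where XY: "X \<subseteq> U" "Y \<subseteq> U" "X' = f ` X" "Y' = f ` Y"
      using surj by metis
    ultimately have "X \<noteq> {}" "X \<subset> Y" "Y \<subset> U"
      using strict[of X Y] strict[of Y U] img by auto
    then have "{X, Y} \<in> snd (subset_graph U)"
      by (auto simp: subset_graph_def)
    moreover have "e = (`) ((`) f) {X, Y}"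
      using XY XY' by simp
    ultimately show "e \<in> (`) ((`) f) ` snd (subset_graph U)"
      by blast
  qed
  moreover have "\<Union>(snd (subset_graph U)) \<subseteq> fst (subset_graph U)"
    by (auto simp: subset_graph_def)
  ultimately show ?thesis
    by (simp add: graph_iso_def)
qed

text \<open>
  The initial segments form a maximal chain. The cardinality minus one is a proper colouring, as
  comparable sets differ in size.
\<close>

lemma subset_graph_clique_number_chromatic_number:
  assumes "n > 0"
  shows "clique_number (subset_graph {..<n}) = enat (n - 1)" (is "?w = _")
    and "chromatic_number (subset_graph {..<n}) = enat (n - 1)" (is "?x = _")
proof -
  have sub: "{..<i} \<subset> {..<j} \<longleftrightarrow> i < j" for i j :: nat
    by (metis lessThan_strict_subset_iff)
  let ?K = "lessThan ` {1..<n}"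
  have ne: "{..<i} \<noteq> {}" if "1 \<le> i" for i :: nat
    using that by (auto simp: lessThan_empty_iff)
  then have "clique ?K (snd (subset_graph {..<n}))"
    unfolding clique_def by (auto simp: subset_graph_edge_iff sub)
  then have "enat (card ?K) \<le> ?w"
    using ne by (intro clique_number_geI) (auto simp: subset_graph_def)
  moreover have "card ?K = n - 1"
    by (subst card_image) (auto simp: inj_on_def)
  ultimately have ge: "enat (n - 1) \<le> ?w" by simp
  have "proper_vertex_colouring (subset_graph {..<n}) (n - 1) (\<lambda>X. card X - 1)"
    unfolding proper_vertex_colouring_def
  proof (intro conjI ballI impI)
    have "0 < card X \<and> card X < n" if "X \<in> fst (subset_graph {..<n})" for X
      using that psubset_card_mono[of "{..<n}" X] finite_subset[of X "{..<n}"]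
      by (auto simp: subset_graph_def card_gt_0_iff)
    then show "(\<lambda>X. card X - 1) ` fst (subset_graph {..<n}) \<subseteq> {..<n - 1}"
      by fastforce
    fix X Y assume e: "{X, Y} \<in> snd (subset_graph {..<n})"
    then have "finite X" "finite Y" "X \<noteq> {}" "Y \<noteq> {}" "X \<subset> Y \<or> Y \<subset> X"
      by (auto simp: subset_graph_edge_iff intro: finite_subset[of _ "{..<n}"])
    moreover from this have "card X < card Y \<or> card Y < card X" "card X > 0" "card Y > 0"
      using psubset_card_mono[of Y X] psubset_card_mono[of X Y] by (auto simp only: card_gt_0_iff)
    ultimately show "card X - 1 \<noteq> card Y - 1" by linarith
  qed
  then have le: "?x \<le> enat (n - 1)"
    by (rule chromatic_number_leI)
  show "?w = enat (n - 1)" "?x = enat (n - 1)"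
    using ge le clique_number_le_chromatic_number[of "subset_graph {..<n}"]
    by (auto intro: antisym order_trans)
qed

lemma card_proper_nonempty_subsets:
  assumes "finite M" "M \<noteq> {}"
  shows "card {X. X \<noteq> {} \<and> X \<subset> M} = 2 ^ card M - 2"
proof -
  have "{X. X \<noteq> {} \<and> X \<subset> M} = Pow M - {{}, M}"
    by auto
  then show ?thesis
    using assms by (simp add: card_Diff_subset card_Pow)
qed

text \<open>
  The bound is the degree of the vertex \<open>{m}\<close>: its neighbours are its proper supersets.
\<close>

lemma subset_graph_edge_chromatic_number_ge:
  assumes "m > 0"
  shows "enat (2 ^ m - 2) \<le> edge_chromatic_number (subset_graph {..<Suc m})"
proof -
  let ?P = "{X. X \<noteq> {} \<and> X \<subset> {..<m}}"
  have new: "\<And>X. X \<in> ?P \<Longrightarrow> m \<notin> X"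
    by auto
  have "inj_on (insert m) ?P"
    by (rule inj_onI) (metis insert_ident new)
  then have "card (insert m ` ?P) = 2 ^ m - 2"
    using card_proper_nonempty_subsets[of "{..<m}"] assms by (simp add: card_image lessThan_empty_iff)
  moreover have "w \<noteq> {m} \<and> {{m}, w} \<in> snd (subset_graph {..<Suc m})" if w: "w \<in> insert m ` ?P" for w
  proof -
    obtain X where X: "w = insert m X" "X \<subset> {..<m}" "X \<noteq> {}"
      using w by blast
    moreover from this have "m \<notin> X" by auto
    ultimately have "{m} \<subset> w" "w \<subset> {..<Suc m}"
      by (auto simp: lessThan_Suc)
    then show ?thesis
      by (auto simp: subset_graph_edge_iff)
  qed
  ultimately show ?thesis
    using degree_le_edge_chromatic_number[of "insert m ` ?P" "{m}" "subset_graph {..<Suc m}"] by simp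
qed

section \<open>From the comparability graph to the laminar graph\<close>

definition laminar_graph :: "'a set \<Rightarrow> 'a set sgraph" where
  "laminar_graph M =
     ({X. X \<subseteq> M \<and> X \<noteq> {}},
      {{X, Y} | X Y. X \<subseteq> M \<and> Y \<subseteq> M \<and> X \<noteq> {} \<and> Y \<noteq> {} \<and> X \<noteq> Y \<and>
         (X \<subseteq> Y \<or> Y \<subseteq> X \<or> X \<inter> Y = {})})"

lemma laminar_graph_edge_iff:
  "{X, Y} \<in> snd (laminar_graph M) \<longleftrightarrow>
     X \<subseteq> M \<and> Y \<subseteq> M \<and> X \<noteq> {} \<and> Y \<noteq> {} \<and> X \<noteq> Y \<and> (X \<subseteq> Y \<or> Y \<subseteq> X \<or> X \<inter> Y = {})"
  by (auto simp: laminar_graph_def doubleton_eq_iff)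

text \<open>
  The names refer to the split of \<open>{..<Suc m}\<close> into \<open>X\<close> and its complement, which is represented by
  the part that avoids \<open>m\<close>.
\<close>

definition split_part :: "nat \<Rightarrow> nat set \<Rightarrow> nat set" where
  "split_part m X = (if m \<in> X then {..<Suc m} - X else X)"

text \<open>
  Passing to splits identifies only complementary sets, and no set is comparable with both \<open>Y\<close> and the
  complement of \<open>Y\<close>. So the map is injective on the neighbours of each vertex.
\<close>

lemma pair_colouring_subset_graph:
  assumes "pair_colouring (laminar_graph {..<m}) C c"
  shows "pair_colouring (subset_graph {..<Suc m}) C (\<lambda>X Y. c (split_part m X) (split_part m Y))"
proof (rule pair_colouring_pullback[OF assms])
  have part: "split_part m X \<subseteq> {..<m}" "split_part m X \<noteq> {}" if "X \<noteq> {}" "X \<subset> {..<Suc m}" for X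
    using that by (auto simp: split_part_def less_Suc_eq)
  have hom: "{split_part m X, split_part m Y} \<in> snd (laminar_graph {..<m})"
    if "X \<noteq> {}" "X \<subset> Y" "Y \<subset> {..<Suc m}" for X Y
  proof -
    have "split_part m X \<noteq> split_part m Y"
      using that unfolding split_part_def by auto
    moreover have "split_part m X \<subseteq> split_part m Y \<or> split_part m Y \<subseteq> split_part m X \<or>
        split_part m X \<inter> split_part m Y = {}"
      using that unfolding split_part_def by auto
    moreover have "Y \<noteq> {}" "X \<subset> {..<Suc m}"
      using that by auto
    ultimately show ?thesis
      using part[of X] part[of Y] that by (simp add: laminar_graph_edge_iff)
  qed
  fix X Y assume "{X, Y} \<in> snd (subset_graph {..<Suc m})"
  then show "{split_part m X, split_part m Y} \<in> snd (laminar_graph {..<m})"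
    using hom[of X Y] hom[of Y X] by (auto simp: subset_graph_edge_iff insert_commute)
next
  fix X Y Z
  assume edges: "{X, Y} \<in> snd (subset_graph {..<Suc m})" "{X, Z} \<in> snd (subset_graph {..<Suc m})"
    and "Y \<noteq> Z"
  show "split_part m Y \<noteq> split_part m Z"
  proof
    assume "split_part m Y = split_part m Z"
    moreover have "A = split_part m A \<or> A = {..<Suc m} - split_part m A"
      and "split_part m A \<subseteq> {..<Suc m}" if "A \<subset> {..<Suc m}" for A
      using that by (auto simp: split_part_def)
    moreover have "Y \<subset> {..<Suc m}" "Z \<subset> {..<Suc m}"
      using edges by (auto simp: subset_graph_edge_iff)
    ultimately have "Z = {..<Suc m} - Y"
      using \<open>Y \<noteq> Z\<close> by (metis double_diff subset_refl)
    moreover have False if "A \<noteq> {}" "B \<noteq> {}" "B \<subset> U" "A \<subset> U" "A \<subset> B \<or> B \<subset> A" "A \<subset> U - B \<or> U - B \<subset> A"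
      for A B U :: "nat set"
      using that by blast
    ultimately show False
      using edges unfolding subset_graph_edge_iff by metis
  qed
qed

text \<open>
  The comparability graph on three points is the hexagon
  \<open>{0}, {0,1}, {1}, {1,2}, {2}, {2,0}\<close>. The colour of the edge from \<open>{a}\<close> to \<open>{a, b}\<close> tells whether \<open>b\<close>
  is the cyclic successor of \<open>a\<close>, which alternates along the hexagon. The intersection \<open>{a}\<close> and the
  union \<open>{a, b}\<close> of the two ends recover the edge, so the colour is symmetric by construction.
\<close>

lemma hexagon_pair_colouring:
  "pair_colouring (subset_graph {..<3::nat}) (UNIV :: bool set)
     (\<lambda>X Y. 0 \<in> X \<inter> Y \<and> 1 \<in> X \<union> Y \<or> 1 \<in> X \<inter> Y \<and> 2 \<in> X \<union> Y \<or> 2 \<in> X \<inter> Y \<and> 0 \<in> X \<union> Y)"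
proof -
  have lt3: "{..<3} = {0, 1, 2 :: nat}" by auto
  have eq: "X = Y \<longleftrightarrow> (0 \<in> X \<longleftrightarrow> 0 \<in> Y) \<and> (1 \<in> X \<longleftrightarrow> 1 \<in> Y) \<and> (2 \<in> X \<longleftrightarrow> 2 \<in> Y)"
    and sub: "X \<subseteq> Y \<longleftrightarrow> (0 \<in> X \<longrightarrow> 0 \<in> Y) \<and> (1 \<in> X \<longrightarrow> 1 \<in> Y) \<and> (2 \<in> X \<longrightarrow> 2 \<in> Y)"
    if "X \<subseteq> {0, 1, 2}" "Y \<subseteq> {0, 1, 2}" for X Y :: "nat set"
    using that by blast+
  have edge: "{X, Y} \<in> snd (subset_graph {..<3::nat}) \<longleftrightarrow> X \<subseteq> {0, 1, 2} \<and> Y \<subseteq> {0, 1, 2} \<and>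
      X \<noteq> {} \<and> Y \<noteq> {} \<and> X \<noteq> {0, 1, 2} \<and> Y \<noteq> {0, 1, 2} \<and> X \<noteq> Y \<and> (X \<subseteq> Y \<or> Y \<subseteq> X)"
    for X Y :: "nat set"
    unfolding lt3 subset_graph_edge_iff psubset_eq by metis
  show ?thesis
    unfolding pair_colouring_def edge
  proof (intro conjI allI impI; (elim conjE)?)
    fix X Y Z :: "nat set"
    assume "X \<subseteq> {0, 1, 2}" "Y \<subseteq> {0, 1, 2}" "Z \<subseteq> {0, 1, 2}"
      and "X \<noteq> {}" "Y \<noteq> {}" "Z \<noteq> {}" "X \<noteq> {0, 1, 2}" "Y \<noteq> {0, 1, 2}" "Z \<noteq> {0, 1, 2}"
      and "X \<noteq> Y" "X \<noteq> Z" "Y \<noteq> Z" "X \<subseteq> Y \<or> Y \<subseteq> X" "X \<subseteq> Z \<or> Z \<subseteq> X"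
    then show "(0 \<in> X \<inter> Y \<and> 1 \<in> X \<union> Y \<or> 1 \<in> X \<inter> Y \<and> 2 \<in> X \<union> Y \<or> 2 \<in> X \<inter> Y \<and> 0 \<in> X \<union> Y) \<noteq>
        (0 \<in> X \<inter> Z \<and> 1 \<in> X \<union> Z \<or> 1 \<in> X \<inter> Z \<and> 2 \<in> X \<union> Z \<or> 2 \<in> X \<inter> Z \<and> 0 \<in> X \<union> Z)"
      by (simp add: eq sub) argo
  qed (simp_all add: Int_commute Un_commute)
qed

text \<open>
  Here the laminar graph is the complete graph on seven vertices without the triangle formed by the
  three pairs, and each of the six colours has to be used on three edges, the largest possible number.
  Call the singletons \<open>0, 1, 2\<close> and the whole set \<open>3\<close>; these four vertices span a complete graph, whose six
  edges receive the six colours, so a colour can be read as a pair \<open>ij\<close> with \<open>i, j \<le> 3\<close>. The edges from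
  vertex \<open>i\<close> to the three pairs must then receive the three colours that do not mention \<open>i\<close>. With
  indices modulo \<open>3\<close>, the complement of the point \<open>k\<close> is joined to \<open>k\<close>, \<open>k+1\<close>, \<open>k+2\<close>, \<open>3\<close> in the
  colours \<open>(k+1)(k+2)\<close>, \<open>(k+2)3\<close>, \<open>(k+1)3\<close>, \<open>k(k+1)\<close>.
\<close>

lemma laminar_pair_colouring_3:
  "\<exists>c. pair_colouring (laminar_graph {..<3::nat}) {..<6::nat} c"
proof -
  \<comment> \<open>Subsets of the three points are encoded by their bit patterns; the pairs are 3, 5 and 6, the whole set is 7.\<close>
  define N where "N = [1, 2, 3, 4, 5, 6, 7 :: nat]"
  \<comment> \<open>The colours 01, 02, 03, 12, 13, 23 are numbered from 0 to 5; non-edges are filled up with 0.\<close>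
  define T :: "nat \<Rightarrow> nat \<Rightarrow> nat" where "T i j =
    [[0, 0, 0, 0, 0, 0, 0, 0],
     [0, 0, 0, 4, 1, 5, 3, 2],
     [0, 0, 0, 2, 3, 1, 5, 4],
     [0, 4, 2, 0, 0, 0, 0, 1],
     [0, 1, 3, 0, 0, 2, 4, 5],
     [0, 5, 1, 0, 2, 0, 0, 3],
     [0, 3, 5, 0, 4, 0, 0, 0],
     [0, 2, 4, 1, 5, 3, 0, 0]] ! i ! j" for i j
  define adj where "adj i j \<longleftrightarrow> i \<noteq> j \<and> \<not> (i \<in> {3, 5, 6} \<and> j \<in> {3, 5, 6})" for i j :: nat
  have T_sym: "\<forall>i\<in>set N. \<forall>j\<in>set N. T i j = T j i \<and> T i j < 6"
    unfolding N_def T_def by simp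
  have T_inj: "\<forall>i\<in>set N. \<forall>j\<in>set N. \<forall>k\<in>set N. adj i j \<longrightarrow> adj i k \<longrightarrow> j \<noteq> k \<longrightarrow> T i j \<noteq> T i k"
    unfolding N_def T_def adj_def by simp
  define code :: "nat set \<Rightarrow> nat" where
    "code X = (if 0 \<in> X then 1 else 0) + (if 1 \<in> X then 2 else 0) + (if 2 \<in> X then 4 else 0)" for X
  have lt3: "{..<3} = {0, 1, 2 :: nat}" by auto
  have code_range: "code X \<in> set N" if "X \<subseteq> {0, 1, 2}" "X \<noteq> {}" for X
  proof -
    have "0 \<in> X \<or> 1 \<in> X \<or> 2 \<in> X" using that by blast
    then show ?thesis by (auto simp: code_def N_def)
  qed
  have code_inj: "code X \<noteq> code Y" if "X \<subseteq> {0, 1, 2}" "Y \<subseteq> {0, 1, 2}" "X \<noteq> Y" for X Y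
  proof -
    have "\<not> ((0 \<in> X \<longleftrightarrow> 0 \<in> Y) \<and> (1 \<in> X \<longleftrightarrow> 1 \<in> Y) \<and> (2 \<in> X \<longleftrightarrow> 2 \<in> Y))"
      using that by blast
    then show ?thesis
      unfolding code_def by (cases "0 \<in> X"; cases "1 \<in> X"; cases "2 \<in> X";
          cases "0 \<in> Y"; cases "1 \<in> Y"; cases "2 \<in> Y"; simp)
  qed
  have two: "(0 \<in> X \<and> 1 \<in> X \<and> 2 \<notin> X) \<or> (0 \<in> X \<and> 2 \<in> X \<and> 1 \<notin> X) \<or> (1 \<in> X \<and> 2 \<in> X \<and> 0 \<notin> X)"
    if "code X \<in> {3, 5, 6}" for X
    using that unfolding code_def by (auto split: if_splits)
  have adj: "adj (code X) (code Y)" if "{X, Y} \<in> snd (laminar_graph {..<3})" for X Y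
  proof -
    have XY: "X \<subseteq> {0, 1, 2}" "Y \<subseteq> {0, 1, 2}" "X \<noteq> Y" "X \<subseteq> Y \<or> Y \<subseteq> X \<or> X \<inter> Y = {}"
      using that unfolding laminar_graph_edge_iff lt3 by blast+
    have "\<not> (code X \<in> {3, 5, 6} \<and> code Y \<in> {3, 5, 6})"
    proof
      assume "code X \<in> {3, 5, 6} \<and> code Y \<in> {3, 5, 6}"
      with two[of X] two[of Y] XY show False by blast
    qed
    then show ?thesis
      using code_inj[OF XY(1-3)] by (simp add: adj_def)
  qed
  have range: "code X \<in> set N" "code Y \<in> set N" if "{X, Y} \<in> snd (laminar_graph {..<3})" for X Y
    using that code_range unfolding laminar_graph_edge_iff lt3 by blast+
  have "pair_colouring (laminar_graph {..<3}) {..<6} (\<lambda>X Y. T (code X) (code Y))"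
    unfolding pair_colouring_def
  proof (intro conjI allI impI)
    fix X Y assume "{X, Y} \<in> snd (laminar_graph {..<3::nat})"
    then show "T (code X) (code Y) \<in> {..<6}" "T (code X) (code Y) = T (code Y) (code X)"
      using T_sym range by blast+
  next
    fix X Y Z
    assume edges: "{X, Y} \<in> snd (laminar_graph {..<3::nat})" "{X, Z} \<in> snd (laminar_graph {..<3})"
      and "Y \<noteq> Z"
    then have "code Y \<noteq> code Z"
      by (intro code_inj) (simp_all add: laminar_graph_edge_iff lt3)
    then show "T (code X) (code Y) \<noteq> T (code X) (code Z)"
      using T_inj range[OF edges(1)] range[OF edges(2)] adj[OF edges(1)] adj[OF edges(2)] by blast
  qed
  then show ?thesis by blast
qed

section \<open>Edge colourings of the laminar graph on at least four points\<close>

text \<open>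
  The choice of this permutation of the points matters only in that, for \<open>m \<ge> 3\<close>, it has no fixed
  points and no cycles of length two, and that the maximum of \<open>{a, cyc m a}\<close> is explicit.
\<close>

definition cyc :: "nat \<Rightarrow> nat \<Rightarrow> nat" where
  "cyc m a = (if Suc a = m then 0 else Suc a)"

text \<open>
  \<open>recoloured m X Y W\<close> says that the edge between \<open>X\<close> and \<open>Y\<close> loses its symmetric difference as a
  colour and gets the colour \<open>W\<close>. Write \<open>M\<close> for the set of all points and \<open>\<pi>\<close> for \<open>cyc m\<close>.
  
  A colour \<open>W\<close> is free at a vertex \<open>X\<close>, that is, it is not the symmetric difference of \<open>X\<close> and a
  neighbour, if \<open>X = W\<close>, or if \<open>X\<close> and \<open>W\<close> intersect and neither contains the other. An edge between
  \<open>X\<close> and \<open>M - X\<close>, both of size at least two, gets a colour that is free at both ends for the second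
  reason: a point of \<open>X\<close> together with a point of \<open>M - X\<close>. If one end is a singleton \<open>{a}\<close> there is no such
  room, since there every colour other than \<open>{a}\<close> is taken. So the edge from \<open>{a}\<close> to \<open>M - {a}\<close> takes the
  colour \<open>{a}\<close>. This is already the colour of the edge from \<open>M - {a}\<close> to \<open>M\<close>, which changes to
  \<open>{\<pi> a}\<close>; at \<open>M\<close> this permutes colours. But \<open>{\<pi> a}\<close> is also the colour of the edge from \<open>M - {a}\<close> to
  \<open>M - {a, \<pi> a}\<close>, and this last edge again has a free colour at both ends, \<open>{a, \<pi> (\<pi> a)}\<close>.
  
  The clauses list the recoloured edges by the kind of the end \<open>X\<close>: a point, \<open>M\<close>, the complement of a
  point, the complement of a pair \<open>{a, \<pi> a}\<close>, and the remaining edges between complementary sets. Each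
  edge is listed from both ends.
\<close>

definition recoloured :: "nat \<Rightarrow> nat set \<Rightarrow> nat set \<Rightarrow> nat set \<Rightarrow> bool" where
  "recoloured m X Y W \<longleftrightarrow>
     (\<exists>a<m. X = {a} \<and> Y = {..<m} - {a} \<and> W = {a}) \<or>
     (\<exists>a<m. X = {..<m} \<and> Y = {..<m} - {a} \<and> W = {cyc m a}) \<or>
     (\<exists>a<m. X = {..<m} - {a} \<and>
        (Y = {a} \<and> W = {a} \<or>
         Y = {..<m} \<and> W = {cyc m a} \<or>
         Y = {..<m} - {a, cyc m a} \<and> W = {a, cyc m (cyc m a)})) \<or>
     (\<exists>a<m. X = {..<m} - {a, cyc m a} \<and> Y = {..<m} - {a} \<and> W = {a, cyc m (cyc m a)}) \<or>
     (X \<subseteq> {..<m} \<and> 2 \<le> card X \<and> card X + 2 \<le> m \<and>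
        Y = {..<m} - X \<and> W = {Max X, Max ({..<m} - X)})"

lemma cyc_less: "a < m \<Longrightarrow> cyc m a < m"
  by (auto simp: cyc_def)

lemma cyc_distinct:
  assumes "a < m" "4 \<le> m"
  shows "cyc m a \<noteq> a" "cyc m (cyc m a) \<noteq> a" "cyc m (cyc m a) \<noteq> cyc m a"
  using assms by (auto simp: cyc_def)

lemma cyc_inj: "a < m \<Longrightarrow> b < m \<Longrightarrow> cyc m a = cyc m b \<Longrightarrow> a = b"
  by (auto simp: cyc_def split: if_splits)

lemma recoloured_sym:
  assumes "recoloured m X Y W"
  shows "recoloured m Y X W"
proof -
  have "recoloured m ({..<m} - X) X {Max X, Max ({..<m} - X)}"
    if "X \<subseteq> {..<m}" "2 \<le> card X" "card X + 2 \<le> m" for X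
  proof -
    have "card ({..<m} - X) = m - card X"
      using that by (simp add: card_Diff_subset finite_subset)
    moreover have "{..<m} - ({..<m} - X) = X"
      using that by auto
    ultimately show ?thesis
      using that unfolding recoloured_def by (auto simp: insert_commute)
  qed
  then show ?thesis
    using assms unfolding recoloured_def[of m X Y W]
    by (elim disjE exE conjE) (simp_all add: recoloured_def, blast+)
qed

lemma recoloured_cases:
  assumes "recoloured m X Y W" "4 \<le> m"
  obtains (singleton) a where "a < m" "X = {a}" "Y = {..<m} - {a}" "W = {a}" "card X = 1"
  | (whole) a where "a < m" "X = {..<m}" "Y = {..<m} - {a}" "W = {cyc m a}" "card X = m"
  | (cosingleton) a where "a < m" "X = {..<m} - {a}" "card X = m - 1"
      "Y = {a} \<and> W = {a} \<or> Y = {..<m} \<and> W = {cyc m a} \<or>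
       Y = {..<m} - {a, cyc m a} \<and> W = {a, cyc m (cyc m a)}"
  | (copair) a where "a < m" "X = {..<m} - {a, cyc m a}" "Y = {..<m} - {a}"
      "W = {a, cyc m (cyc m a)}" "card X = m - 2"
  | (middle) "X \<subseteq> {..<m}" "2 \<le> card X" "card X + 2 \<le> m" "Y = {..<m} - X"
      "W = {Max X, Max ({..<m} - X)}"
proof -
  have "card ({..<m} - {a, cyc m a}) = m - 2" if "a < m" for a
    using cyc_less[OF that] cyc_distinct(1)[OF that assms(2)] that
    by (subst card_Diff_subset) auto
  then show ?thesis
    using assms that unfolding recoloured_def by (elim disjE exE conjE) simp_all
qed

lemma copair_eq_iff:
  assumes "a < m" "b < m" "4 \<le> m" "{..<m} - {a, cyc m a} = {..<m} - {b, cyc m b}"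
  shows "a = b"
proof -
  have sub: "{a, cyc m a} \<subseteq> {..<m}" "{b, cyc m b} \<subseteq> {..<m}"
    using assms(1,2) cyc_less by simp_all
  have "{a, cyc m a} = {..<m} - ({..<m} - {a, cyc m a})"
    using double_diff[OF sub(1) subset_refl] by (rule sym)
  also have "\<dots> = {b, cyc m b}"
    unfolding assms(4) using sub(2) by (rule double_diff) simp
  finally show ?thesis
    using cyc_distinct(2)[of b m] assms by (auto simp: doubleton_eq_iff)
qed

lemma cosingleton_eq_iff:
  assumes "a < m" "b < m" "{..<m} - {a} = {..<m} - {b}"
  shows "a = b"
  using assms by (metis DiffI Diff_iff insert_iff lessThan_iff singletonD)

text \<open>
  The complement \<open>X\<close> of \<open>{a, \<pi> a}\<close> is an end of two recoloured edges, one to \<open>M - {a}\<close> and one to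
  \<open>{a, \<pi> a}\<close>. The maxima in the colour of the second are what separates it from the colour
  \<open>{a, \<pi> (\<pi> a)}\<close> of the first: the maximum of \<open>{a, \<pi> a}\<close> is \<open>\<pi> a\<close>, which is not in the first colour,
  unless \<open>a\<close> is the last point; then \<open>\<pi> (\<pi> a) = 1\<close>, which is smaller than the maximum of \<open>X\<close>.
\<close>

lemma copair_colour_neq_middle_colour:
  assumes "a < m" "4 \<le> m"
  defines "X \<equiv> {..<m} - {a, cyc m a}"
  shows "{a, cyc m (cyc m a)} \<noteq> {Max X, Max ({..<m} - X)}"
proof -
  have compl: "{..<m} - X = {a, cyc m a}"
    using assms cyc_less[of a m] by (auto simp: X_def)
  show ?thesis
  proof (cases "Suc a = m")
    case False
    then have "Max ({..<m} - X) = cyc m a"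
      unfolding compl by (simp add: cyc_def)
    then show ?thesis
      using cyc_distinct[OF assms(1,2)] by (auto simp: doubleton_eq_iff)
  next
    case True
    have "m - 2 \<in> X" "finite X"
      using assms True by (auto simp: X_def cyc_def)
    then have "m - 2 \<le> Max X" by simp
    moreover have "cyc m (cyc m a) = 1" "Max ({..<m} - X) = a"
      unfolding compl using True assms by (auto simp: cyc_def)
    ultimately show ?thesis
      using assms True by (auto simp: doubleton_eq_iff)
  qed
qed

text \<open>
  At a fixed vertex \<open>X\<close> the new colour and the other end of a recoloured edge determine each other:
  the recolouring is a function of the edge, and it gives distinct colours to distinct edges at \<open>X\<close>.
  The size of \<open>X\<close> decides which kinds of recoloured edges can meet there; different kinds meet only at
  complements of points and at complements of pairs \<open>{a, \<pi> a}\<close>.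
\<close>

lemma recoloured_eq_iff:
  assumes "recoloured m X Y W" "recoloured m X Y' W'" "4 \<le> m"
  shows "Y = Y' \<longleftrightarrow> W = W'"
proof -
  have copair_middle: "{..<m} - {a} \<noteq> {..<m} - X \<and> {a, cyc m (cyc m a)} \<noteq> {Max X, Max ({..<m} - X)}"
    if "a < m" "X = {..<m} - {a, cyc m a}" for a
  proof
    show "{..<m} - {a} \<noteq> {..<m} - X"
      using \<open>X = _\<close> cyc_less[OF cyc_less[OF \<open>a < m\<close>]] cyc_distinct[OF \<open>a < m\<close> assms(3)] by blast
    show "{a, cyc m (cyc m a)} \<noteq> {Max X, Max ({..<m} - X)}"
      using copair_colour_neq_middle_colour[OF \<open>a < m\<close> assms(3)] that(2) by simp
  qed
  from assms(1,3) show ?thesis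
  proof (cases rule: recoloured_cases)
    case (singleton a)
    from assms(2,3) show ?thesis
      by (cases rule: recoloured_cases) (use singleton assms(3) in auto)
  next
    case (whole a)
    from assms(2,3) show ?thesis
    proof (cases rule: recoloured_cases)
      case (whole b)
      then show ?thesis
        using \<open>a < m\<close> \<open>Y = _\<close> \<open>W = _\<close> cosingleton_eq_iff[of a m b] cyc_inj[of a m b] by auto
    qed (use whole assms(3) in auto)
  next
    case (cosingleton a)
    from assms(2,3) show ?thesis
    proof (cases rule: recoloured_cases)
      case (cosingleton b)
      then have "b = a"
        using \<open>a < m\<close> \<open>X = {..<m} - {a}\<close> cosingleton_eq_iff[of a m b] by simp
      have "a \<in> {..<m}" "cyc m a \<in> {..<m}" "cyc m a \<noteq> a"
        using \<open>a < m\<close> cyc_less cyc_distinct(1)[OF _ assms(3)] by auto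
      then have "{a} \<noteq> {..<m}" "{a} \<noteq> {..<m} - {a, cyc m a}" "{..<m} \<noteq> {..<m} - {a, cyc m a}"
        by blast+
      moreover have "{a} \<noteq> {cyc m a}" "{a} \<noteq> {a, cyc m (cyc m a)}"
          "{cyc m a} \<noteq> {a, cyc m (cyc m a)}"
        using cyc_distinct[OF \<open>a < m\<close> assms(3)] by auto
      ultimately show ?thesis
        using \<open>Y = {a} \<and> W = {a} \<or> _\<close> cosingleton(4) unfolding \<open>b = a\<close> by metis
    qed (use cosingleton assms(3) in auto)
  next
    case (copair a)
    from assms(2,3) show ?thesis
    proof (cases rule: recoloured_cases)
      case (copair b)
      then show ?thesis
        using \<open>a < m\<close> \<open>X = {..<m} - {a, cyc m a}\<close> \<open>Y = _\<close> \<open>W = _\<close> copair_eq_iff[of a m b] assms(3) by simp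
    next
      case middle
      then show ?thesis
        using copair copair_middle[of a] by simp
    qed (use copair assms(3) in auto)
  next
    case middle
    from assms(2,3) show ?thesis
    proof (cases rule: recoloured_cases)
      case (copair b)
      then show ?thesis
        using middle copair_middle[of b] by metis
    qed (use middle assms(3) in auto)
  qed
qed

lemma sym_diff_inj: "sym_diff X Y = sym_diff X Z \<Longrightarrow> Y = Z"
  by auto

lemma sym_diff_commute: "sym_diff X Y = sym_diff Y X"
  by auto

lemma sym_diff_eq_iff: "sym_diff X Y = W \<longleftrightarrow> Y = sym_diff X W"
  by auto

text \<open>
  Two sets whose symmetric difference consists of a point \<open>p\<close> of \<open>X\<close> and a point outside \<open>X\<close> are not
  nested, and if \<open>X\<close> has a further point they are not disjoint either. This is why a colour made of a
  point inside and a point outside is free at \<open>X\<close>.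
\<close>

lemma laminar_graph_no_swap_edge:
  assumes "{X, Y} \<in> snd (laminar_graph M)" "sym_diff X Y = {p, q}" "p \<in> X" "q \<notin> X"
  shows "X \<subseteq> {p}"
  using assms by (auto simp: laminar_graph_edge_iff)

lemma Max_middle_in:
  assumes "X \<subseteq> {..<m}" "2 \<le> card X" "card X + 2 \<le> m"
  shows "Max X \<in> X" "Max ({..<m} - X) \<in> {..<m} - X"
proof -
  have fin: "finite X" using assms(1) by (rule finite_subset) simp
  have "X \<noteq> {}" "X \<noteq> {..<m}"
    using assms by auto
  then have "{..<m} - X \<noteq> {}"
    using assms(1) by blast
  with fin \<open>X \<noteq> {}\<close> show "Max X \<in> X" "Max ({..<m} - X) \<in> {..<m} - X"
    by (meson Max_in finite_Diff finite_lessThan)+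
qed

text \<open>
  A new colour \<open>W\<close> does not clash with an old one: if an edge at the same vertex had \<open>W\<close> as its old
  colour, then this edge has itself been recoloured. For the vertex \<open>M\<close>, and for the colours \<open>{a}\<close> and
  \<open>{\<pi> a}\<close> at \<open>M - {a}\<close>, there is such an edge; in the other cases the colour \<open>W\<close> is free at \<open>X\<close>.
\<close>

lemma recoloured_closed:
  assumes "recoloured m X Y W" and m: "4 \<le> m"
    and edge: "{X, Z} \<in> snd (laminar_graph {..<m})" and sum: "sym_diff X Z = W"
  shows "\<exists>W'. recoloured m X Z W'"
proof -
  have Z: "Z = sym_diff X W"
    using sum sym_diff_eq_iff by metis
  from assms(1) m show ?thesis
  proof (cases rule: recoloured_cases)
    case singleton
    then show ?thesis
      using Z edge by (simp add: laminar_graph_edge_iff)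
  next
    case (whole a)
    then have "Z = {..<m} - {cyc m a}"
      using Z cyc_less[of a m] by auto
    then show ?thesis
      unfolding recoloured_def using whole cyc_less[of a m] by auto
  next
    case (cosingleton a)
    note cyc = cyc_less[OF \<open>a < m\<close>] cyc_less[OF cyc_less[OF \<open>a < m\<close>]] cyc_distinct[OF \<open>a < m\<close> m]
    from cosingleton(4) show ?thesis
    proof (elim disjE conjE)
      assume "W = {a}"
      then have "Z = {..<m}"
        using Z cosingleton by auto
      then show ?thesis
        unfolding recoloured_def using cosingleton by blast
    next
      assume "W = {cyc m a}"
      then have "Z = {..<m} - {a, cyc m a}"
        using Z cosingleton cyc by auto
      then show ?thesis
        unfolding recoloured_def using cosingleton by blast
    next
      assume "W = {a, cyc m (cyc m a)}"
      then have "X \<subseteq> {cyc m (cyc m a)}"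
        using cyc cosingleton sum
        by (intro laminar_graph_no_swap_edge[OF edge, of _ a]) (auto simp: insert_commute)
      moreover have "cyc m a \<in> X"
        using cyc(1,3) cosingleton(2) by simp
      ultimately show ?thesis
        using cyc(5) by (metis singletonD subsetD)
    qed
  next
    case (copair a)
    note cyc = cyc_less[OF cyc_less[OF \<open>a < m\<close>]] cyc_distinct[OF \<open>a < m\<close> m]
    have "X \<subseteq> {cyc m (cyc m a)}"
      using cyc copair sum
      by (intro laminar_graph_no_swap_edge[OF edge, of _ a]) (auto simp: insert_commute)
    then have "card X \<le> 1"
      using card_mono[of "{cyc m (cyc m a)}" X] by simp
    then show ?thesis
      using copair m by simp
  next
    case middle
    note Max_middle_in[OF middle(1-3)]
    then have "X \<subseteq> {Max X}"
      using middle sum by (intro laminar_graph_no_swap_edge[OF edge, of _ "Max ({..<m} - X)"]) auto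
    then have "card X \<le> 1"
      using card_mono[of "{Max X}" X] by simp
    then show ?thesis
      using middle by simp
  qed
qed

text \<open>
  The old colour of these edges is \<open>M\<close>, which thereby disappears.
\<close>

lemma recoloured_complement:
  assumes "X \<subseteq> {..<m}" "X \<noteq> {}" "X \<noteq> {..<m}"
  shows "\<exists>W. recoloured m X ({..<m} - X) W"
proof -
  have fin: "finite X" using assms(1) by (rule finite_subset) simp
  have compl: "card ({..<m} - X) = m - card X" "{..<m} - ({..<m} - X) = X"
    using assms fin by (auto simp: card_Diff_subset)
  have one: "\<exists>W. recoloured m Y ({..<m} - Y) W" if "card Y = 1" "Y \<subseteq> {..<m}" for Y
  proof -
    obtain a where "Y = {a}"
      using \<open>card Y = 1\<close> by (rule card_1_singletonE)
    then have "recoloured m Y ({..<m} - Y) {a}"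
      using that(2) by (auto simp: recoloured_def)
    then show ?thesis ..
  qed
  have "0 < card X" "card X < m"
    using assms fin psubset_card_mono[of "{..<m}" X] by (auto simp: card_gt_0_iff)
  then consider "card X = 1" | "card ({..<m} - X) = 1" | "2 \<le> card X \<and> card X + 2 \<le> m"
    using compl by linarith
  then show ?thesis
  proof cases
    case 2
    then show ?thesis
      using one[of "{..<m} - X"] compl recoloured_sym by fastforce
  next
    case 3
    then show ?thesis
      using assms unfolding recoloured_def by auto
  qed (use one assms in auto)
qed

lemma recoloured_colour:
  assumes "recoloured m X Y W" "4 \<le> m"
  shows "W \<noteq> {} \<and> W \<subset> {..<m}"
proof -
  have small: "W \<subset> {..<m}" if "W \<subseteq> {..<m}" "W = {p, q}" for p q
  proof -
    have "card W \<le> 2"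
      unfolding that(2) by (rule card_insert_le_m1) auto
    then have "W \<noteq> {..<m}"
      using assms(2) by auto
    then show ?thesis using that by auto
  qed
  from assms show ?thesis
  proof (cases rule: recoloured_cases)
    case middle
    note Max_middle_in[OF middle(1-3)]
    then have "W \<subseteq> {..<m}"
      using middle by auto
    then show ?thesis
      using small middle(5) by auto
  next
    case (singleton a)
    then show ?thesis using small[of a a] by auto
  next
    case (whole a)
    then show ?thesis using small[of "cyc m a" "cyc m a"] cyc_less[of a m] by auto
  next
    case (cosingleton a)
    then show ?thesis
      using small[of a a] small[of "cyc m a" "cyc m a"] small[of a "cyc m (cyc m a)"]
        cyc_less[of a m] cyc_less[of "cyc m a" m] by auto
  next
    case (copair a)
    then show ?thesis
      using small[of a "cyc m (cyc m a)"] cyc_less[of a m] cyc_less[of "cyc m a" m] by auto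
  qed
qed

text \<open>
  At one vertex, two old colours differ because symmetric differences cancel, two new ones by
  \<open>recoloured_eq_iff\<close>, and an old one differs from a new one by \<open>recoloured_closed\<close>.
\<close>

lemma laminar_pair_colouring:
  fixes m :: nat
  assumes "4 \<le> m"
  shows "\<exists>c. pair_colouring (laminar_graph {..<m}) {W. W \<noteq> {} \<and> W \<subset> {..<m}} c"
proof -
  define c where "c X Y = (if \<exists>W. recoloured m X Y W then SOME W. recoloured m X Y W else sym_diff X Y)"
    for X Y
  have c_rec: "c X Y = W" if "recoloured m X Y W" for X Y W
  proof -
    have "recoloured m X Y (c X Y)"
      using that someI[of "recoloured m X Y"] by (auto simp: c_def)
    then show ?thesis
      using recoloured_eq_iff[OF that _ assms] by metis
  qed
  have c_sum: "c X Y = sym_diff X Y" if "\<nexists>W. recoloured m X Y W" for X Y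
    using that by (simp add: c_def)
  have sym: "c X Y = c Y X" for X Y
    by (metis c_rec c_sum recoloured_sym sym_diff_commute)
  have colour: "c X Y \<in> {W. W \<noteq> {} \<and> W \<subset> {..<m}}" if "{X, Y} \<in> snd (laminar_graph {..<m})" for X Y
  proof (cases "\<exists>W. recoloured m X Y W")
    case True
    then show ?thesis
      using c_rec recoloured_colour[OF _ assms] by fastforce
  next
    case False
    have XY: "X \<subseteq> {..<m}" "Y \<subseteq> {..<m}" "X \<noteq> {}" "Y \<noteq> {}" "X \<noteq> Y"
      using that by (auto simp: laminar_graph_edge_iff)
    have "sym_diff X Y \<noteq> {..<m}"
    proof
      assume "sym_diff X Y = {..<m}"
      then have "Y = {..<m} - X"
        using XY by auto
      then show False
        using False XY recoloured_complement[of X m] by auto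
    qed
    moreover have "sym_diff X Y \<noteq> {}" "sym_diff X Y \<subseteq> {..<m}"
      using XY by auto
    ultimately show ?thesis
      using c_sum[OF False] by auto
  qed
  have mixed: "c X Y \<noteq> c X Z"
    if "recoloured m X Y W" "\<nexists>W. recoloured m X Z W" "{X, Z} \<in> snd (laminar_graph {..<m})" for X Y Z W
    using recoloured_closed[OF that(1) assms that(3)] c_rec[OF that(1)] c_sum[OF that(2)] that(2) by metis
  have "c X Y \<noteq> c X Z"
    if "{X, Y} \<in> snd (laminar_graph {..<m})" "{X, Z} \<in> snd (laminar_graph {..<m})" "Y \<noteq> Z" for X Y Z
  proof (cases "(\<exists>W. recoloured m X Y W) \<longleftrightarrow> (\<exists>W. recoloured m X Z W)")
    case True
    then show ?thesis
      using that(3) c_rec c_sum recoloured_eq_iff[OF _ _ assms] sym_diff_inj by metis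
  next
    case False
    then show ?thesis
      using mixed that by metis
  qed
  then have "pair_colouring (laminar_graph {..<m}) {W. W \<noteq> {} \<and> W \<subset> {..<m}} c"
    unfolding pair_colouring_def using sym colour by (intro conjI allI impI) assumption+
  then show ?thesis by blast
qed

section \<open>The edge chromatic number of the comparability graph\<close>

lemma subset_graph_edge_chromatic_number:
  assumes "2 \<le> m"
  shows "edge_chromatic_number (subset_graph {..<Suc m}) = enat (2 ^ m - 2)"
proof (rule antisym)
  consider "m = 2" | "m = 3" | "4 \<le> m"
    using assms by linarith
  then show "edge_chromatic_number (subset_graph {..<Suc m}) \<le> enat (2 ^ m - 2)"
  proof cases
    case 1
    then show ?thesis
      using edge_chromatic_number_le_pair_colouring[OF hexagon_pair_colouring]
      by (auto simp: subset_graph_def)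
  next
    case 2
    obtain c where "pair_colouring (laminar_graph {..<m}) {..<6::nat} c"
      using laminar_pair_colouring_3 2 by auto
    from edge_chromatic_number_le_pair_colouring[OF pair_colouring_subset_graph[OF this]]
    show ?thesis
      using 2 by (auto simp: subset_graph_def)
  next
    case 3
    let ?C = "{W. W \<noteq> {} \<and> W \<subset> {..<m}}"
    obtain c where "pair_colouring (laminar_graph {..<m}) ?C c"
      using laminar_pair_colouring[OF 3] by blast
    from pair_colouring_subset_graph[OF this]
    have "edge_chromatic_number (subset_graph {..<Suc m}) \<le> enat (card ?C)"
      by (rule edge_chromatic_number_le_pair_colouring)
        (auto simp: subset_graph_def intro: finite_subset[of _ "Pow {..<m}"])
    then show ?thesis
      using card_proper_nonempty_subsets[of "{..<m}"] 3 by (simp add: lessThan_empty_iff)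
  qed
  show "enat (2 ^ m - 2) \<le> edge_chromatic_number (subset_graph {..<Suc m})"
    using assms by (intro subset_graph_edge_chromatic_number_ge) simp
qed

section \<open>Edges of the regular graph of ideals\<close>

lemma regular_ideal_graph_edge_iff:
  "{I, J} \<in> snd (regular_ideal_graph R) \<longleftrightarrow>
     I \<in> nontrivial_ideals R \<and> J \<in> nontrivial_ideals R \<and> I \<noteq> J \<and>
     ((\<exists>x\<in>I. ideal_regular R J x) \<or> (\<exists>x\<in>J. ideal_regular R I x))"
  by (auto simp: regular_ideal_graph_def doubleton_eq_iff)

lemma regular_ideal_graph_edgeE:
  assumes "e \<in> snd (regular_ideal_graph R)"
  obtains I J where "e = {I, J}" "ideal I R" "ideal J R"
  using assms unfolding regular_ideal_graph_def nontrivial_ideals_def snd_conv by blast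

section \<open>Minimal primes of a reduced ring\<close>

lemma (in ideal) add_mem_iff:
  assumes "x \<in> I" "y \<in> carrier R"
  shows "x \<oplus> y \<in> I \<longleftrightarrow> y \<in> I"
proof
  assume "x \<oplus> y \<in> I"
  then have "\<ominus> x \<oplus> (x \<oplus> y) \<in> I"
    using assms(1) by (simp add: a_closed a_inv_closed)
  then show "y \<in> I"
    using assms a_Hcarr by (simp add: r_neg1)
qed (use assms(1) a_closed in blast)

lemma (in cring) reduced_pow_eq_zero:
  assumes "reduced_ring R" "x \<in> carrier R" "x [^] (k::nat) = \<zero>"
  shows "x = \<zero>"
proof (cases "k = 0")
  case True
  then have "\<one> = \<zero>" using assms(3) by simp
  then show ?thesis using assms(2) r_one[of x] by simp
next
  case False
  then show ?thesis using assms by (auto simp: reduced_ring_def)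
qed

text \<open>
  Among the multiplicatively closed sets that contain \<open>x\<close> but not \<open>0\<close> choose a maximal one, \<open>S\<close>. By
  maximality, for each \<open>a\<close> outside \<open>S\<close> some \<open>s a\<^sup>k\<close> with \<open>s \<in> S\<close> vanishes, and since the ring is reduced
  already \<open>s a = 0\<close>. So the complement of \<open>S\<close> consists of the elements that are annihilated by an element
  of \<open>S\<close>. This description shows that the complement is a prime ideal, and that it lies in every prime
  ideal disjoint from \<open>S\<close>, so that it is minimal.
\<close>

lemma (in cring) exists_minimal_prime_avoiding:
  assumes reduced: "reduced_ring R" and x: "x \<in> carrier R" "x \<noteq> \<zero>"
  shows "\<exists>P\<in>minimal_primes R. x \<notin> P"
proof -
  define M where "M = {S. S \<subseteq> carrier R \<and> x \<in> S \<and> \<one> \<in> S \<and> \<zero> \<notin> S \<and> (\<forall>a\<in>S. \<forall>b\<in>S. a \<otimes> b \<in> S)}"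
  have "\<exists>S\<in>M. \<forall>T\<in>M. S \<subseteq> T \<longrightarrow> T = S"
  proof (rule subset_Zorn_nonempty)
    have "range (\<lambda>k::nat. x [^] k) \<in> M"
      unfolding M_def
    proof (intro CollectI conjI)
      show "range (\<lambda>k::nat. x [^] k) \<subseteq> carrier R" using x by auto
      show "x \<in> range (\<lambda>k::nat. x [^] k)" using x nat_pow_Suc[of x 0] by (metis l_one nat_pow_0 rangeI)
      show "\<one> \<in> range (\<lambda>k::nat. x [^] k)" by (metis nat_pow_0 rangeI)
      show "\<zero> \<notin> range (\<lambda>k::nat. x [^] k)"
        using reduced_pow_eq_zero[OF reduced x(1)] x(2) by (metis imageE)
      show "\<forall>a\<in>range (\<lambda>k::nat. x [^] k). \<forall>b\<in>range (\<lambda>k::nat. x [^] k).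
          a \<otimes> b \<in> range (\<lambda>k::nat. x [^] k)"
        using x nat_pow_mult[of x] by auto
    qed
    then show "M \<noteq> {}" by blast
  next
    fix C assume C: "C \<noteq> {}" "subset.chain M C"
    have "a \<otimes> b \<in> \<Union>C" if ab: "a \<in> \<Union>C" "b \<in> \<Union>C" for a b
    proof -
      obtain A B where AB: "A \<in> C" "a \<in> A" "B \<in> C" "b \<in> B"
        using ab by blast
      then have "A \<subseteq> B \<or> B \<subseteq> A"
        using C(2) unfolding subset.chain_def by blast
      then obtain E where "E \<in> C" "a \<in> E" "b \<in> E"
        using AB by blast
      moreover have "E \<in> M"
        using C(2) \<open>E \<in> C\<close> unfolding subset.chain_def by blast
      ultimately show ?thesis by (auto simp: M_def)
    qed
    moreover have "C \<subseteq> M"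
      using C(2) by (simp add: subset.chain_def)
    moreover have "\<Union>C \<subseteq> carrier R" "\<zero> \<notin> \<Union>C"
      using \<open>C \<subseteq> M\<close> by (auto simp: M_def)
    moreover obtain A where "A \<in> C" "A \<in> M"
      using C(1) \<open>C \<subseteq> M\<close> by blast
    then have "x \<in> \<Union>C" "\<one> \<in> \<Union>C" by (auto simp: M_def)
    ultimately show "\<Union>C \<in> M"
      unfolding M_def by (intro CollectI conjI ballI)
  qed
  then obtain S where SM: "S \<in> M" and max: "\<And>T. T \<in> M \<Longrightarrow> S \<subseteq> T \<Longrightarrow> T = S"
    by blast
  then have S: "S \<subseteq> carrier R" "x \<in> S" "\<one> \<in> S" "\<zero> \<notin> S"
    and S_mult: "\<And>a b. a \<in> S \<Longrightarrow> b \<in> S \<Longrightarrow> a \<otimes> b \<in> S"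
    by (simp_all add: M_def)
  have S_pow: "a [^] (k::nat) \<in> S" if "a \<in> S" for a k
    using that S S_mult by (induction k) auto
  have annihilated: "\<exists>s\<in>S. s \<otimes> a = \<zero>" if a: "a \<in> carrier R" "a \<notin> S" for a
  proof -
    \<comment> \<open>The multiplicatively closed set generated by the elements of S and by a\<close>
    let ?T = "{s \<otimes> a [^] k | s k. s \<in> S \<and> k \<in> (UNIV :: nat set)}"
    have T_mult: "t \<otimes> t' \<in> ?T" if tt': "t \<in> ?T" "t' \<in> ?T" for t t'
    proof -
      obtain s k s' k' where st: "s \<in> S" "t = s \<otimes> a [^] (k::nat)" "s' \<in> S" "t' = s' \<otimes> a [^] (k'::nat)"
        using tt' by blast
      then have "s \<in> carrier R" "s' \<in> carrier R" using S by auto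
      then have "t \<otimes> t' = (s \<otimes> s') \<otimes> a [^] (k + k')"
        using st a(1) by (simp add: nat_pow_mult[symmetric] m_ac)
      then show ?thesis
        using S_mult[OF st(1,3)] by blast
    qed
    have ST: "S \<subseteq> ?T"
    proof
      fix s assume s: "s \<in> S"
      then have "s = s \<otimes> a [^] (0::nat)"
        using S by auto
      with s show "s \<in> ?T" by blast
    qed
    have "a = \<one> \<otimes> a [^] (1::nat)"
      using a(1) by simp
    then have "a \<in> ?T"
      using S(3) by blast
    then have "?T \<noteq> S" using a(2) by blast
    moreover have "?T \<subseteq> carrier R"
      using S(1) a(1) by auto
    moreover have "x \<in> ?T" "\<one> \<in> ?T"
      using ST S(2,3) by blast+
    ultimately have "\<zero> \<in> ?T"
      using max[OF _ ST] T_mult unfolding M_def by blast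
    then obtain s k where sk: "s \<in> S" "s \<otimes> a [^] (k::nat) = \<zero>"
      by force
    then have s: "s \<in> carrier R" using S by blast
    have "(s \<otimes> a) [^] Suc k = (s [^] k \<otimes> a) \<otimes> (s \<otimes> a [^] k)"
      using s a(1) by (simp add: nat_pow_distrib m_ac)
    also have "\<dots> = \<zero>"
      using sk s a(1) by simp
    finally have "s \<otimes> a = \<zero>"
      by (rule reduced_pow_eq_zero[OF reduced m_closed[OF s a(1)]])
    then show ?thesis using sk(1) by blast
  qed
  have not_S: "a \<notin> S" if "s \<in> S" "s \<otimes> a = \<zero>" for s a
    using S_mult[OF that(1), of a] that(2) S(4) by auto
  let ?P = "carrier R - S"
  have add: "a \<oplus> b \<in> ?P" if ab: "a \<in> ?P" "b \<in> ?P" for a b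
  proof -
    obtain s t where st: "s \<in> S" "s \<otimes> a = \<zero>" "t \<in> S" "t \<otimes> b = \<zero>"
      using annihilated ab by blast
    then have "s \<in> carrier R" "t \<in> carrier R" using S by auto
    then have "(s \<otimes> t) \<otimes> (a \<oplus> b) = t \<otimes> (s \<otimes> a) \<oplus> s \<otimes> (t \<otimes> b)"
      using ab by (simp add: r_distr m_ac)
    then have "(s \<otimes> t) \<otimes> (a \<oplus> b) = \<zero>"
      using st \<open>s \<in> carrier R\<close> \<open>t \<in> carrier R\<close> by simp
    then show ?thesis
      using not_S[OF S_mult[OF st(1,3)]] ab by auto
  qed
  have mult: "r \<otimes> a \<in> ?P" if ra: "r \<in> carrier R" "a \<in> ?P" for r a
  proof -
    obtain s where s: "s \<in> S" "s \<otimes> a = \<zero>"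
      using annihilated ra by blast
    then have "s \<otimes> (r \<otimes> a) = \<zero>"
      using S ra m_lcomm[of s r a] by auto
    then show ?thesis
      using not_S[OF s(1)] ra by auto
  qed
  have "ideal ?P R"
  proof (rule idealI)
    show "subgroup ?P (add_monoid R)"
    proof (rule add.subgroupI)
      show "?P \<noteq> {}" using S(4) by blast
      fix a assume a: "a \<in> ?P"
      then have "\<ominus> a = (\<ominus> \<one>) \<otimes> a"
        by (simp add: l_minus)
      then show "\<ominus> a \<in> ?P"
        using mult[OF _ a, of "\<ominus> \<one>"] by simp
    qed (use add in auto)
    show "a \<otimes> r \<in> ?P" if "a \<in> ?P" "r \<in> carrier R" for a r
      using mult[of r a] that by (simp add: m_comm)
  qed (use mult ring_axioms in auto)
  then have prime: "primeideal ?P R"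
    using S S_mult by (intro primeidealI is_cring) auto
  have "Q = ?P" if Q: "primeideal Q R" "Q \<subseteq> ?P" for Q
  proof -
    interpret Q: primeideal Q R by fact
    have "a \<in> Q" if a: "a \<in> ?P" for a
    proof -
      obtain s where s: "s \<in> S" "s \<otimes> a = \<zero>"
        using annihilated a by blast
      then have "s \<in> Q \<or> a \<in> Q"
        using a S(1) Q.zero_closed by (intro Q.I_prime) auto
      then show ?thesis
        using s(1) Q(2) by blast
    qed
    then show ?thesis using Q(2) by blast
  qed
  then have "?P \<in> minimal_primes R"
    using prime by (simp add: minimal_primes_def)
  then show ?thesis
    using S(2) by (intro bexI[of _ ?P]) auto
qed

section \<open>Reduced rings whose non-zero-divisors are units\<close>

text \<open>
  The name is geometric: on the space of minimal primes, \<open>locus R J\<close> is the open set on which \<open>J\<close> does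
  not vanish.
\<close>

definition locus :: "('a, 'b) ring_scheme \<Rightarrow> 'a set \<Rightarrow> 'a set set" where
  "locus R J = {P \<in> minimal_primes R. \<not> J \<subseteq> P}"

abbreviation elem_locus :: "('a, 'b) ring_scheme \<Rightarrow> 'a \<Rightarrow> 'a set set" where
  "elem_locus R x \<equiv> locus R {x}"

locale reduced_total_ring = cring R for R (structure) +
  assumes reduced: "reduced_ring R"
    and finite_minimal_primes: "finite (minimal_primes R)"
    and unit_if_regular: "\<lbrakk>x \<in> carrier R; x \<notin> zero_divisors R\<rbrakk> \<Longrightarrow> x \<in> Units R"
begin

lemma minimal_prime:
  assumes "P \<in> minimal_primes R"
  shows "primeideal P R" "ideal P R"
  using assms by (auto simp: minimal_primes_def primeideal_def)

lemma locus_carrier: "locus R (carrier R) = minimal_primes R"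
proof -
  have "\<not> carrier R \<subseteq> P" if "P \<in> minimal_primes R" for P
    using primeideal.I_notcarr[OF minimal_prime(1)[OF that]] ideal.Icarr[OF minimal_prime(2)[OF that]]
    by auto
  then show ?thesis by (auto simp: locus_def)
qed

lemma elem_locus_mult:
  assumes "x \<in> carrier R" "y \<in> carrier R"
  shows "elem_locus R (x \<otimes> y) = elem_locus R x \<inter> elem_locus R y"
proof -
  have "x \<otimes> y \<in> P \<longleftrightarrow> x \<in> P \<or> y \<in> P" if "P \<in> minimal_primes R" for P
    using primeideal.I_prime[OF minimal_prime(1)[OF that] assms]
      ideal.I_l_closed[OF minimal_prime(2)[OF that]] ideal.I_r_closed[OF minimal_prime(2)[OF that]] assms
    by blast
  then show ?thesis by (auto simp: locus_def)
qed

lemma elem_locus_add: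
  assumes "x \<in> carrier R" "y \<in> carrier R" "elem_locus R x \<inter> elem_locus R y = {}"
  shows "elem_locus R (x \<oplus> y) = elem_locus R x \<union> elem_locus R y"
proof -
  have "x \<oplus> y \<in> P \<longleftrightarrow> x \<in> P \<and> y \<in> P" if P: "P \<in> minimal_primes R" for P
  proof -
    have "x \<in> P \<or> y \<in> P"
      using P assms(3) by (auto simp: locus_def)
    then show ?thesis
      using ideal.add_mem_iff[OF minimal_prime(2)[OF P]] assms(1,2) a_comm[of x y] by metis
  qed
  then show ?thesis by (auto simp: locus_def)
qed

lemma elem_locus_eq_empty_iff:
  assumes "x \<in> carrier R"
  shows "elem_locus R x = {} \<longleftrightarrow> x = \<zero>"
proof
  assume "elem_locus R x = {}"
  then show "x = \<zero>"
    using exists_minimal_prime_avoiding[OF reduced assms] by (auto simp: locus_def)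
next
  assume "x = \<zero>"
  then show "elem_locus R x = {}"
    using additive_subgroup.zero_closed[OF ideal.axioms(1)[OF minimal_prime(2)]] by (auto simp: locus_def)
qed

lemma elem_locus_zero: "elem_locus R \<zero> = {}"
  by (simp add: elem_locus_eq_empty_iff)

text \<open>
  If \<open>x\<close> lies in no minimal prime, then \<open>x y = 0\<close> puts \<open>y\<close> in all of them, so \<open>y = 0\<close>; hence \<open>x\<close> is not
  a zero-divisor.
\<close>

lemma unit_if_full_locus:
  assumes x: "x \<in> carrier R" and full: "elem_locus R x = minimal_primes R"
  shows "x \<in> Units R"
proof (rule unit_if_regular[OF x])
  have "y = \<zero>" if "y \<in> carrier R" "x \<otimes> y = \<zero>" for y
  proof -
    have "elem_locus R y = elem_locus R (x \<otimes> y)"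
      unfolding elem_locus_mult[OF x that(1)] full by (auto simp: locus_def)
    then show ?thesis
      using that elem_locus_zero elem_locus_eq_empty_iff by simp
  qed
  then show "x \<notin> zero_divisors R"
    by (auto simp: zero_divisors_def)
qed

text \<open>
  Minimal primes are pairwise incomparable, so each \<open>Q \<noteq> P\<close> has an element outside \<open>P\<close>. The product of
  such elements, one for each \<open>Q\<close>, times an element of \<open>J\<close> outside \<open>P\<close>, lies outside \<open>P\<close> and in
  all other minimal primes.
\<close>

lemma ideal_elem_locus_singleton:
  assumes J: "ideal J R" and P: "P \<in> locus R J"
  shows "\<exists>z\<in>J. elem_locus R z = {P}"
proof -
  have PM: "P \<in> minimal_primes R" using P by (simp add: locus_def)
  obtain x where x: "x \<in> J" "x \<notin> P" using P by (auto simp: locus_def)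
  interpret J: ideal J R by fact
  interpret P: primeideal P R by (rule minimal_prime(1)[OF PM])
  have "\<exists>a\<in>carrier R. a \<notin> P \<and> (\<forall>Q\<in>F. a \<in> Q)"
    if "finite F" "F \<subseteq> minimal_primes R - {P}" for F
    using that
  proof (induction F)
    case empty
    then show ?case
      using P.one_imp_carrier P.I_notcarr one_closed by blast
  next
    case (insert Q F)
    then obtain a where a: "a \<in> carrier R" "a \<notin> P" "\<forall>Q\<in>F. a \<in> Q" by auto
    have QM: "Q \<in> minimal_primes R" "Q \<noteq> P" using insert.prems by auto
    then have "\<not> Q \<subseteq> P"
      using PM minimal_prime(1)[OF QM(1)] unfolding minimal_primes_def by blast
    then obtain b where b: "b \<in> Q" "b \<notin> P" by blast
    have bR: "b \<in> carrier R"
      using b(1) ideal.Icarr[OF minimal_prime(2)[OF QM(1)]] by blast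
    have "a \<otimes> b \<in> T" if "T \<in> insert Q F" for T
    proof -
      have "ideal T R" using that insert.prems minimal_prime(2) by blast
      then show ?thesis
        using that a b bR ideal.I_l_closed ideal.I_r_closed by (metis insertE)
    qed
    then show ?case
      using a b bR P.I_prime[of a b] by blast
  qed
  from this[of "minimal_primes R - {P}"] finite_minimal_primes
  obtain a where a: "a \<in> carrier R" "a \<notin> P" "\<And>Q. Q \<in> minimal_primes R \<Longrightarrow> Q \<noteq> P \<Longrightarrow> a \<in> Q"
    by auto
  have "elem_locus R (a \<otimes> x) = elem_locus R a \<inter> elem_locus R x"
    using a x J.Icarr by (simp add: elem_locus_mult)
  also have "\<dots> = {P}"
    using a x PM by (auto simp: locus_def)
  finally show ?thesis
    using J.I_l_closed[OF x(1) a(1)] by blast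
qed

text \<open>
  Elements with disjoint loci add up to an element whose locus is the union, so the singletons of the
  previous lemma can be collected one at a time.
\<close>

lemma ideal_elem_locus_exists:
  assumes J: "ideal J R" and F: "F \<subseteq> locus R J"
  shows "\<exists>z\<in>J. elem_locus R z = F"
proof -
  interpret J: ideal J R by fact
  have "finite F"
    using F finite_minimal_primes by (auto simp: locus_def intro: finite_subset[of F])
  then show ?thesis
    using F
  proof (induction F)
    case empty
    then show ?case
      using J.zero_closed elem_locus_zero by blast
  next
    case (insert P F)
    then obtain z where z: "z \<in> J" "elem_locus R z = F" by auto
    obtain y where y: "y \<in> J" "elem_locus R y = {P}"
      using ideal_elem_locus_singleton[OF J] insert.prems by blast
    have "elem_locus R (y \<oplus> z) = insert P F"
      using elem_locus_add[of y z] y z insert.hyps J.Icarr by simp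
    then show ?case
      using J.a_closed y z by blast
  qed
qed

text \<open>
  Choose \<open>w\<close> whose locus is the complement of that of \<open>z\<close>. Then \<open>z + w\<close> lies in no minimal prime, so it
  is a unit, and \<open>x w = 0\<close> because the loci of \<open>x\<close> and \<open>w\<close> are disjoint. Hence \<open>x (z + w) = x z\<close>, and
  \<open>x\<close> is a multiple of \<open>z\<close>.
\<close>

lemma dvd_if_elem_locus_subset:
  assumes x: "x \<in> carrier R" and z: "z \<in> carrier R" and sub: "elem_locus R x \<subseteq> elem_locus R z"
  shows "\<exists>r\<in>carrier R. x = r \<otimes> z"
proof -
  obtain w where w: "w \<in> carrier R" "elem_locus R w = minimal_primes R - elem_locus R z"
    using ideal_elem_locus_exists[OF oneideal, of "minimal_primes R - elem_locus R z"] locus_carrier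
    by auto
  have "elem_locus R (x \<otimes> w) = {}"
    using elem_locus_mult[OF x w(1)] w(2) sub by auto
  then have xw: "x \<otimes> w = \<zero>"
    using elem_locus_eq_empty_iff x w(1) by simp
  have "elem_locus R (z \<oplus> w) = minimal_primes R"
    using elem_locus_add[OF z w(1)] w(2) by (auto simp: locus_def)
  then have u: "z \<oplus> w \<in> Units R"
    using unit_if_full_locus z w(1) by simp
  obtain v where v: "v \<in> carrier R" "v \<otimes> (z \<oplus> w) = \<one>"
    using u Units_l_inv Units_inv_closed by blast
  have "x = x \<otimes> (v \<otimes> (z \<oplus> w))"
    using v x by simp
  also have "\<dots> = v \<otimes> (x \<otimes> z \<oplus> x \<otimes> w)"
    using v(1) x z w(1) by (simp add: r_distr m_ac)
  also have "\<dots> = (v \<otimes> x) \<otimes> z"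
    using v x z by (simp add: xw m_assoc)
  finally show ?thesis
    using v x by (metis m_closed)
qed

text \<open>
  An ideal contains an element with any prescribed locus inside its own, and this element divides
  every element with the same locus. So the locus determines the ideal.
\<close>

lemma ideal_mem_iff_elem_locus_subset:
  assumes J: "ideal J R" and x: "x \<in> carrier R"
  shows "x \<in> J \<longleftrightarrow> elem_locus R x \<subseteq> locus R J"
proof
  assume "x \<in> J"
  then show "elem_locus R x \<subseteq> locus R J" by (auto simp: locus_def)
next
  assume "elem_locus R x \<subseteq> locus R J"
  then obtain z where z: "z \<in> J" "elem_locus R z = elem_locus R x"
    using ideal_elem_locus_exists[OF J] by blast
  then obtain r where "r \<in> carrier R" "x = r \<otimes> z"
    using dvd_if_elem_locus_subset[OF x] ideal.Icarr[OF J] by blast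
  then show "x \<in> J"
    using ideal.I_l_closed[OF J z(1)] by simp
qed

lemma locus_inj:
  assumes "ideal J R" "ideal K R" "locus R J = locus R K"
  shows "J = K"
proof -
  have "x \<in> J \<longleftrightarrow> x \<in> K" for x
    using ideal_mem_iff_elem_locus_subset[OF assms(1), of x]
      ideal_mem_iff_elem_locus_subset[OF assms(2), of x]
      ideal.Icarr[OF assms(1), of x] ideal.Icarr[OF assms(2), of x] assms(3) by metis
  then show ?thesis by blast
qed

lemma locus_zero: "locus R {\<zero>} = {}"
  by (rule elem_locus_zero)

lemma locus_surj:
  assumes "A \<subseteq> minimal_primes R"
  shows "\<exists>J. ideal J R \<and> locus R J = A"
proof -
  obtain z where z: "z \<in> carrier R" "elem_locus R z = A"
    using ideal_elem_locus_exists[OF oneideal] assms locus_carrier by auto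
  have "PIdl z \<subseteq> P \<longleftrightarrow> z \<in> P" if "P \<in> minimal_primes R" for P
    using cgenideal_minimal[OF minimal_prime(2)[OF that]] cgenideal_self[OF z(1)] by blast
  then have "locus R (PIdl z) = A"
    using z(2) by (auto simp: locus_def)
  then show ?thesis
    using cgenideal_ideal[OF z(1)] by blast
qed

text \<open>
  For \<open>P\<close> in the locus of \<open>K\<close>, some \<open>y \<in> K\<close> has the locus \<open>{P}\<close>, and \<open>x y \<noteq> 0\<close> forces \<open>P\<close> into the
  locus of \<open>x\<close>. Conversely, an element \<open>z\<close> of \<open>J\<close> with the largest possible locus does not change
  the locus of any element of \<open>K\<close> that it multiplies, and so does not annihilate it.
\<close>

lemma contains_regular_iff_locus_subset:
  assumes J: "ideal J R" and K: "ideal K R"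
  shows "(\<exists>x\<in>J. ideal_regular R K x) \<longleftrightarrow> locus R K \<subseteq> locus R J"
proof
  assume "\<exists>x\<in>J. ideal_regular R K x"
  then obtain x where x: "x \<in> J" "ideal_regular R K x" by blast
  have xR: "x \<in> carrier R" using ideal.Icarr[OF J x(1)] .
  show "locus R K \<subseteq> locus R J"
  proof
    fix P assume "P \<in> locus R K"
    then obtain y where y: "y \<in> K" "elem_locus R y = {P}"
      using ideal_elem_locus_singleton[OF K] by blast
    have yR: "y \<in> carrier R" using ideal.Icarr[OF K y(1)] .
    then have "x \<otimes> y \<noteq> \<zero>"
      using x(2) y elem_locus_zero by (auto simp: ideal_regular_def)
    then have "elem_locus R x \<inter> {P} \<noteq> {}"
      using elem_locus_mult[OF xR yR] elem_locus_eq_empty_iff[of "x \<otimes> y"] xR yR y(2) by simp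
    then show "P \<in> locus R J"
      using ideal_mem_iff_elem_locus_subset[OF J xR] x(1) by blast
  qed
next
  assume sub: "locus R K \<subseteq> locus R J"
  obtain z where z: "z \<in> J" "elem_locus R z = locus R J"
    using ideal_elem_locus_exists[OF J] by blast
  have zR: "z \<in> carrier R" using ideal.Icarr[OF J z(1)] .
  have "z \<otimes> y \<noteq> \<zero>" if y: "y \<in> K" "y \<noteq> \<zero>" for y
  proof -
    have yR: "y \<in> carrier R" using ideal.Icarr[OF K y(1)] .
    have "elem_locus R (z \<otimes> y) = elem_locus R y"
      using elem_locus_mult[OF zR yR] ideal_mem_iff_elem_locus_subset[OF K yR] y(1) z(2) sub by auto
    then show ?thesis
      using y(2) elem_locus_eq_empty_iff[OF yR] elem_locus_eq_empty_iff[of "z \<otimes> y"] zR yR by simp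
  qed
  then show "\<exists>x\<in>J. ideal_regular R K x"
    using z(1) zR by (auto simp: ideal_regular_def)
qed

theorem regular_ideal_graph_iso_subset_graph:
  "graph_iso (locus R) (regular_ideal_graph R) (subset_graph (minimal_primes R))"
proof -
  let ?M = "minimal_primes R"
  let ?V = "nontrivial_ideals R"
  have V_iff: "J \<in> ?V \<longleftrightarrow> ideal J R \<and> locus R J \<noteq> {} \<and> locus R J \<subset> ?M" for J
  proof -
    have "locus R J \<subseteq> ?M" by (auto simp: locus_def)
    moreover have "J = {\<zero>} \<longleftrightarrow> locus R J = {}" "J = carrier R \<longleftrightarrow> locus R J = ?M" if "ideal J R"
      using locus_inj[OF that] zeroideal oneideal locus_zero locus_carrier by blast+
    ultimately show ?thesis
      by (auto simp: nontrivial_ideals_def)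
  qed
  have edge_iff: "{I, J} \<in> snd (regular_ideal_graph R) \<longleftrightarrow>
      I \<in> ?V \<and> J \<in> ?V \<and> (locus R I \<subset> locus R J \<or> locus R J \<subset> locus R I)" for I J
  proof -
    have "{I, J} \<in> snd (regular_ideal_graph R) \<longleftrightarrow> I \<in> ?V \<and> J \<in> ?V \<and> I \<noteq> J \<and> (locus R J \<subseteq> locus R I \<or> locus R I \<subseteq> locus R J)"
      unfolding regular_ideal_graph_edge_iff using contains_regular_iff_locus_subset V_iff by blast
    also have "\<dots> \<longleftrightarrow> I \<in> ?V \<and> J \<in> ?V \<and> (locus R I \<subset> locus R J \<or> locus R J \<subset> locus R I)"
      using locus_inj V_iff by blast
    finally show ?thesis .
  qed
  have "bij_betw (locus R) ?V {X. X \<subseteq> ?M \<and> X \<noteq> {} \<and> X \<noteq> ?M}"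
    unfolding bij_betw_def
  proof
    show "inj_on (locus R) ?V"
      using locus_inj V_iff by (auto simp: inj_on_def)
    show "locus R ` ?V = {X. X \<subseteq> ?M \<and> X \<noteq> {} \<and> X \<noteq> ?M}"
    proof (intro subset_antisym subsetI)
      fix X assume "X \<in> {X. X \<subseteq> ?M \<and> X \<noteq> {} \<and> X \<noteq> ?M}"
      moreover from this obtain J where "ideal J R" "locus R J = X"
        using locus_surj[of X] by blast
      ultimately show "X \<in> locus R ` ?V"
        using V_iff[of J] by blast
    qed (use V_iff in auto)
  qed
  moreover have "(`) (locus R) ` snd (regular_ideal_graph R) = snd (subset_graph ?M)"
  proof (intro subset_antisym subsetI)
    fix e assume "e \<in> (`) (locus R) ` snd (regular_ideal_graph R)"
    then obtain d where d: "d \<in> snd (regular_ideal_graph R)" "e = locus R ` d" by blast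
    obtain I J where "d = {I, J}" using d(1) by (rule regular_ideal_graph_edgeE)
    then have "e = {locus R I, locus R J}" "{I, J} \<in> snd (regular_ideal_graph R)"
      using d by simp_all
    then show "e \<in> snd (subset_graph ?M)"
      using edge_iff[of I J] V_iff[of I] V_iff[of J] by (simp add: subset_graph_edge_iff)
  next
    fix e assume "e \<in> snd (subset_graph ?M)"
    then obtain X Y where XY: "e = {X, Y}" "X \<noteq> {}" "X \<subset> Y" "Y \<subset> ?M"
      by (auto simp: subset_graph_def)
    moreover obtain I J where IJ: "ideal I R" "locus R I = X" "ideal J R" "locus R J = Y"
      using XY locus_surj[of X] locus_surj[of Y] by blast
    ultimately have "{I, J} \<in> snd (regular_ideal_graph R)"
      unfolding edge_iff V_iff by blast
    moreover have "e = (`) (locus R) {I, J}"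
      using XY IJ by simp
    ultimately show "e \<in> (`) (locus R) ` snd (regular_ideal_graph R)" by blast
  qed
  moreover have "\<Union> (snd (regular_ideal_graph R)) \<subseteq> fst (regular_ideal_graph R)"
    by (auto simp: regular_ideal_graph_def)
  ultimately show ?thesis
    by (simp add: graph_iso_def regular_ideal_graph_def[of R] subset_graph_def[of ?M])
qed

end

section \<open>A finite clique number makes non-zero-divisors invertible\<close>

text \<open>
  For a non-zero-divisor \<open>x\<close> without an inverse, \<open>x\<^sup>k = r x\<^sup>l\<close> with \<open>k < l\<close> could be cancelled to
  \<open>1 = r x\<^sup>l\<^sup>-\<^sup>k\<close>, so the powers of \<open>x\<close> generate pairwise distinct proper ideals. As \<open>x\<^sup>k\<close> is regular on every
  ideal, all these ideals are adjacent to each other.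
\<close>

lemma (in cring) regular_elem_unit_if_finite_clique_number:
  assumes finite: "clique_number (regular_ideal_graph R) < \<infinity>" and one: "\<one> \<noteq> \<zero>"
    and x: "x \<in> carrier R" "x \<notin> zero_divisors R"
  shows "x \<in> Units R"
proof (rule ccontr)
  assume not_unit: "x \<notin> Units R"
  have no_inv: "r \<otimes> x \<noteq> \<one>" if "r \<in> carrier R" for r
    using that not_unit x(1) m_comm[of r x] by (auto simp: Units_def)
  note sub = submonoid_non_zero_divisors[OF is_cring]
  have pow: "x [^] k \<in> carrier R - zero_divisors R" for k :: nat
  proof (induction k)
    case 0
    show ?case using submonoid.one_closed[OF sub] by simp
  next
    case (Suc k)
    then show ?case using submonoid.m_closed[OF sub, of "x [^] k" x] x by simp
  qed
  have regular: "y = \<zero>" if "y \<in> carrier R" "x [^] k \<otimes> y = \<zero>" for y and k :: nat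
    using pow[of k] that by (auto simp: zero_divisors_def)
  let ?I = "\<lambda>k::nat. PIdl (x [^] k)"
  have no_factor: "x [^] k \<noteq> r \<otimes> x [^] l" if kl: "k < l" and r: "r \<in> carrier R" for k l :: nat and r
  proof
    assume eq: "x [^] k = r \<otimes> x [^] l"
    define d where "d = l - Suc k"
    have "l = k + d + 1" using kl by (simp add: d_def)
    then have "x [^] l = x [^] k \<otimes> (x [^] d \<otimes> x)"
      using x(1) by (simp add: nat_pow_mult[symmetric] m_assoc)
    then have "x [^] k \<otimes> (\<one> \<ominus> (r \<otimes> x [^] d) \<otimes> x) = \<zero>"
      using eq x(1) r by (simp add: minus_eq r_distr r_minus m_ac r_neg)
    then have "\<one> \<ominus> (r \<otimes> x [^] d) \<otimes> x = \<zero>"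
      using x(1) r by (rule_tac regular[of _ k]) auto
    moreover have "\<one> = (\<one> \<ominus> (r \<otimes> x [^] d) \<otimes> x) \<oplus> (r \<otimes> x [^] d) \<otimes> x"
      using x(1) r by (simp add: minus_eq a_assoc l_neg)
    ultimately have "(r \<otimes> x [^] d) \<otimes> x = \<one>"
      using x(1) r by simp
    then show False
      using no_inv r x(1) by simp
  qed
  have mem: "x [^] k \<in> ?I k" for k
    using x(1) by (simp add: cgenideal_self)
  have differ: "x [^] k \<notin> ?I l" if "k < l" for k l
    using no_factor[OF that] by (auto simp: cgenideal_def)
  have inj: "inj ?I"
    using mem differ by (auto simp: inj_def) (metis nat_neq_iff)
  have vertex: "?I k \<in> nontrivial_ideals R" if "k > 0" for k
  proof -
    have "x [^] k \<noteq> \<zero>"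
      using regular[of \<one> k] one by auto
    moreover have "\<one> \<notin> ?I k"
      using differ[OF that] by simp
    ultimately show ?thesis
      using cgenideal_ideal[of "x [^] k"] mem[of k] x(1) by (auto simp: nontrivial_ideals_def)
  qed
  have adjacent: "{?I k, ?I l} \<in> snd (regular_ideal_graph R)" if "k > 0" "l > 0" "?I k \<noteq> ?I l" for k l
  proof -
    have "ideal_regular R (?I l) (x [^] k)"
      using regular[of _ k] nat_pow_closed[OF x(1)] ideal.Icarr[OF cgenideal_ideal[of "x [^] l"]]
      unfolding ideal_regular_def by blast
    then show ?thesis
      using vertex that mem[of k] unfolding regular_ideal_graph_def snd_conv by blast
  qed
  have "enat N \<le> clique_number (regular_ideal_graph R)" for N
  proof -
    have "clique (?I ` {1..N}) (snd (regular_ideal_graph R))"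
      using adjacent by (auto simp: clique_def)
    then have "enat (card (?I ` {1..N})) \<le> clique_number (regular_ideal_graph R)"
      using vertex by (intro clique_number_geI) (auto simp: regular_ideal_graph_def)
    then show ?thesis
      using inj by (simp add: card_image inj_on_subset[of _ UNIV])
  qed
  moreover obtain c where "clique_number (regular_ideal_graph R) = enat c"
    using finite by (cases "clique_number (regular_ideal_graph R)") auto
  ultimately have "enat (Suc c) \<le> enat c" by metis
  then show False by simp
qed

section \<open>Passage to the total ring of fractions\<close>

lemma ring_iso_image_ideal:
  assumes "ring R" "ring T" "h \<in> ring_iso R T" "ideal J R"
  shows "ideal (h ` J) T"
proof -
  interpret R: ring R by fact
  interpret T: ring T by fact
  interpret J: ideal J R by fact
  have hom: "h \<in> ring_hom R T" and img: "h ` carrier R = carrier T"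
    using assms(3) by (auto simp: ring_iso_def bij_betw_def)
  interpret h: ring_hom_ring R T h
    by (intro ring_hom_ringI2 assms hom)
  show ?thesis
  proof (rule idealI[OF assms(2)])
    show "subgroup (h ` J) (add_monoid T)"
      using group_hom.subgroup_img_is_subgroup[OF h.a_group_hom J.a_subgroup] .
  next
    fix b t assume "b \<in> h ` J" "t \<in> carrier T"
    then obtain a r where "a \<in> J" "b = h a" "r \<in> carrier R" "t = h r"
      unfolding img[symmetric] by blast
    then show "t \<otimes>\<^bsub>T\<^esub> b \<in> h ` J" "b \<otimes>\<^bsub>T\<^esub> t \<in> h ` J"
      using J.I_l_closed J.I_r_closed J.Icarr h.hom_mult by (metis imageI)+
  qed
qed

lemma regular_ideal_graph_iso:
  assumes "ring R" "ring T" and h: "h \<in> ring_iso R T"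
  shows "graph_iso ((`) h) (regular_ideal_graph R) (regular_ideal_graph T)"
proof -
  interpret R: ring R by fact
  interpret T: ring T by fact
  have bij: "inj_on h (carrier R)" "h ` carrier R = carrier T"
    using h by (auto simp: ring_iso_def bij_betw_def)
  interpret h: ring_hom_ring R T h
    using h by (intro ring_hom_ringI2 assms) (simp add: ring_iso_def)
  have zero_iff: "h x = \<zero>\<^bsub>T\<^esub> \<longleftrightarrow> x = \<zero>\<^bsub>R\<^esub>" if "x \<in> carrier R" for x
    using inj_onD[OF bij(1), of x "\<zero>\<^bsub>R\<^esub>"] that by auto
  have ideal_sub: "J \<subseteq> carrier R" if "ideal J R" for J
    using ideal.Icarr[OF that] by blast
  have img_eq: "h ` I = h ` J \<longleftrightarrow> I = J" if "I \<subseteq> carrier R" "J \<subseteq> carrier R" for I J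
    using inj_on_image_eq_iff[OF bij(1) that] .
  have surj: "\<exists>J. ideal J R \<and> K = h ` J" if K: "ideal K T" for K
  proof -
    let ?g = "inv_into (carrier R) h"
    have "ideal (?g ` K) R"
      using ring_iso_image_ideal[OF assms(2,1) ring_iso_set_sym[OF assms(1) h] K] .
    moreover have "h ` ?g ` K = K"
      using ideal.Icarr[OF K] bij(2) by (intro image_inv_into_cancel) auto
    ultimately show ?thesis by metis
  qed
  have nontrivial: "h ` J \<in> nontrivial_ideals T \<longleftrightarrow> J \<in> nontrivial_ideals R" if J: "ideal J R" for J
    using ring_iso_image_ideal[OF assms J] img_eq[of J "{\<zero>\<^bsub>R\<^esub>}"] img_eq[of J "carrier R"] J
      ideal_sub[OF J] bij(2) by (auto simp: nontrivial_ideals_def)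
  have regular: "ideal_regular T (h ` J) (h x) \<longleftrightarrow> ideal_regular R J x"
    if "ideal J R" "x \<in> carrier R" for J x
  proof -
    have "h x \<otimes>\<^bsub>T\<^esub> h y = \<zero>\<^bsub>T\<^esub> \<longleftrightarrow> x \<otimes>\<^bsub>R\<^esub> y = \<zero>\<^bsub>R\<^esub>" if "y \<in> J" for y
    proof -
      have y: "y \<in> carrier R" using that ideal_sub[OF \<open>ideal J R\<close>] by blast
      show ?thesis
        using zero_iff[of "x \<otimes>\<^bsub>R\<^esub> y"] \<open>x \<in> carrier R\<close> y
        by (simp only: h.hom_mult[symmetric] R.m_closed)
    qed
    moreover have "h y = \<zero>\<^bsub>T\<^esub> \<longleftrightarrow> y = \<zero>\<^bsub>R\<^esub>" if "y \<in> J" for y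
      using zero_iff that ideal_sub[OF \<open>ideal J R\<close>] by auto
    ultimately show ?thesis
      using that by (simp add: ideal_regular_def)
  qed
  have edge: "{h ` I, h ` J} \<in> snd (regular_ideal_graph T) \<longleftrightarrow> {I, J} \<in> snd (regular_ideal_graph R)"
    if "ideal I R" "ideal J R" for I J
  proof -
    have ex: "(\<exists>x\<in>h ` I. ideal_regular T (h ` J) x) \<longleftrightarrow> (\<exists>x\<in>I. ideal_regular R J x)"
      if "ideal I R" "ideal J R" for I J
      using regular[OF that(2)] ideal_sub[OF that(1)] by auto
    show ?thesis
      unfolding regular_ideal_graph_edge_iff using that nontrivial ex img_eq ideal_sub by metis
  qed
  have "bij_betw ((`) h) (nontrivial_ideals R) (nontrivial_ideals T)"
    unfolding bij_betw_def
  proof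
    show "inj_on ((`) h) (nontrivial_ideals R)"
      using img_eq ideal_sub by (auto simp: inj_on_def nontrivial_ideals_def)
    show "(`) ((`) h) (nontrivial_ideals R) = nontrivial_ideals T"
    proof (intro subset_antisym subsetI)
      fix K assume "K \<in> (`) ((`) h) (nontrivial_ideals R)"
      then show "K \<in> nontrivial_ideals T"
        using nontrivial by (auto simp: nontrivial_ideals_def[of R])
    next
      fix K assume K: "K \<in> nontrivial_ideals T"
      then obtain J where "ideal J R" "K = h ` J"
        using surj[of K] by (auto simp: nontrivial_ideals_def)
      then show "K \<in> (`) ((`) h) (nontrivial_ideals R)"
        using K nontrivial by blast
    qed
  qed
  moreover have "(`) ((`) h) ` snd (regular_ideal_graph R) = snd (regular_ideal_graph T)"
  proof (intro subset_antisym subsetI)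
    fix e assume "e \<in> (`) ((`) h) ` snd (regular_ideal_graph R)"
    then obtain d where d: "d \<in> snd (regular_ideal_graph R)" "e = (`) h ` d" by blast
    from d(1) obtain I J where IJ: "d = {I, J}" "ideal I R" "ideal J R"
      by (rule regular_ideal_graph_edgeE)
    then have "{I, J} \<in> snd (regular_ideal_graph R)" "e = {h ` I, h ` J}"
      using d by simp_all
    with IJ(2,3) show "e \<in> snd (regular_ideal_graph T)"
      using edge by simp
  next
    fix e assume e: "e \<in> snd (regular_ideal_graph T)"
    then obtain K L where KL: "e = {K, L}" "ideal K T" "ideal L T"
      by (rule regular_ideal_graph_edgeE)
    obtain I J where IJ: "ideal I R" "K = h ` I" "ideal J R" "L = h ` J"
      using surj[OF KL(2)] surj[OF KL(3)] by blast
    then have "{I, J} \<in> snd (regular_ideal_graph R)"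
      using e KL edge by simp
    moreover have "e = (`) ((`) h) {I, J}"
      using KL IJ by simp
    ultimately show "e \<in> (`) ((`) h) ` snd (regular_ideal_graph R)" by blast
  qed
  moreover have "\<Union> (snd (regular_ideal_graph R)) \<subseteq> fst (regular_ideal_graph R)"
    by (auto simp: regular_ideal_graph_def)
  ultimately show ?thesis
    by (simp add: graph_iso_def regular_ideal_graph_def)
qed

text \<open>
  Every denominator is already invertible, so \<open>r / s\<close> is the image of \<open>r s\<^sup>-\<^sup>1\<close>.
\<close>

lemma (in cring) total_fraction_ring_iso:
  assumes units: "\<And>x. \<lbrakk>x \<in> carrier R; x \<notin> zero_divisors R\<rbrakk> \<Longrightarrow> x \<in> Units R"
  shows "(\<lambda>r. frac_class R (carrier R - zero_divisors R) r \<one>) \<in> ring_iso R (total_fraction_ring R)"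
proof -
  define S where S: "S = carrier R - zero_divisors R"
  have unit: "s \<in> Units R" if "s \<in> S" for s
    using that units by (simp add: S)
  interpret S: submonoid S R
    unfolding S by (rule submonoid_non_zero_divisors[OF is_cring])
  interpret L: ring_localization R S by unfold_locales
  show ?thesis
    unfolding total_fraction_ring_def S[symmetric]
  proof (rule ring_iso_memI)
    let ?h = "\<lambda>r. frac_class R S r \<one>"
    have one: "\<one> \<in> S" by (rule S.one_closed)
    show "?h r \<in> carrier (localization R S)" if "r \<in> carrier R" for r
      using that one by (rule L.frac_closed)
    show "?h (r \<otimes> s) = ?h r \<otimes>\<^bsub>localization R S\<^esub> ?h s" if "r \<in> carrier R" "s \<in> carrier R" for r s
      using L.frac_mult[OF that(1) one that(2) one]
      by (simp only: r_one one_closed)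
    show "?h (r \<oplus> s) = ?h r \<oplus>\<^bsub>localization R S\<^esub> ?h s" if "r \<in> carrier R" "s \<in> carrier R" for r s
      using L.frac_add[OF that(1) one that(2) one]
      by (simp only: r_one that one_closed)
    show "?h \<one> = \<one>\<^bsub>localization R S\<^esub>"
      by (rule L.localization_one[symmetric])
    show "bij_betw ?h (carrier R) (carrier (localization R S))"
      unfolding bij_betw_def
    proof
      show "inj_on ?h (carrier R)"
      proof (rule inj_onI)
        fix r s assume rs: "r \<in> carrier R" "s \<in> carrier R" "?h r = ?h s"
        have "\<exists>t\<in>S. t \<otimes> (r \<otimes> \<one>) = t \<otimes> (s \<otimes> \<one>)"
          using rs(3) by (simp only: L.frac_eq_iff[OF rs(1) one rs(2) one])
        then obtain t where t: "t \<in> S" "t \<otimes> (r \<otimes> \<one>) = t \<otimes> (s \<otimes> \<one>)" ..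
        have "t \<in> Units R" using unit t(1) .
        moreover have "t \<otimes> r = t \<otimes> s" using t(2) rs(1,2) by (simp only: r_one)
        ultimately show "r = s" using rs(1,2) Units_l_cancel by blast
      qed
      have "X \<in> ?h ` carrier R" if X: "X \<in> carrier (localization R S)" for X
      proof -
        obtain r s where rs: "r \<in> carrier R" "s \<in> S" "X = frac_class R S r s"
          using L.frac_cases[OF X] by blast
        have s: "s \<in> Units R" using unit rs(2) .
        have "X = ?h (r \<otimes> inv s)"
          unfolding rs(3)
        proof (rule L.frac_eqI)
          show "r \<otimes> \<one> = r \<otimes> inv s \<otimes> s"
            using rs(1) s by (simp add: m_assoc Units_l_inv Units_closed)
        qed (use rs one s in blast)+
        then show ?thesis
          using rs(1) s by blast
      qed
      then show "?h ` carrier R = carrier (localization R S)"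
        using L.frac_closed[OF _ one] by blast
    qed
  qed
qed

section \<open>Clique, chromatic and edge chromatic numbers of the regular graph of ideals\<close>

theorem theorem9:
  fixes R :: "('a, 'b) ring_scheme" and n :: nat
  assumes "cring R"
    and "reduced_ring R"
    and "n \<ge> 3"
    and "card (minimal_primes R) = n"
    and "clique_number (regular_ideal_graph R) < \<infinity>"
  shows "clique_number (regular_ideal_graph R) = enat (n - 1)
       \<and> chromatic_number (regular_ideal_graph R) = enat (n - 1)
       \<and> chromatic_number (regular_ideal_graph (total_fraction_ring R)) = enat (n - 1)
       \<and> clique_number (regular_ideal_graph (total_fraction_ring R)) = enat (n - 1)
       \<and> edge_chromatic_number (regular_ideal_graph R) = enat (2 ^ (n - 1) - 2)
       \<and> edge_chromatic_number (regular_ideal_graph (total_fraction_ring R)) = enat (2 ^ (n - 1) - 2)"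
proof -
  interpret R: cring R by fact
  let ?T = "total_fraction_ring R"
  have finite: "finite (minimal_primes R)" "minimal_primes R \<noteq> {}"
    using assms(3,4) card.infinite[of "minimal_primes R"] by auto
  then obtain P where "primeideal P R"
    by (auto simp: minimal_primes_def)
  then interpret P: primeideal P R .
  have "\<one>\<^bsub>R\<^esub> \<noteq> \<zero>\<^bsub>R\<^esub>"
    using P.one_imp_carrier P.zero_closed P.I_notcarr by metis
  note unit = R.regular_elem_unit_if_finite_clique_number[OF assms(5) this]
  interpret R: reduced_total_ring R
    using assms(2) finite(1) unit by unfold_locales
  obtain f where "bij_betw f (minimal_primes R) {..<n}"
    using ex_bij_betw_finite_nat[OF finite(1)] assms(4) by (auto simp: atLeast0LessThan)
  note iso = graph_iso_invariants[OF R.regular_ideal_graph_iso_subset_graph]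
    graph_iso_invariants[OF subset_graph_iso[OF this]]
    graph_iso_invariants[OF regular_ideal_graph_iso[OF R.ring_axioms _ R.total_fraction_ring_iso[OF unit]]]
  have T: "ring ?T"
    using total_fraction_ring_cring[OF assms(1)] by (simp add: cring_def)
  have "edge_chromatic_number (subset_graph {..<n}) = enat (2 ^ (n - 1) - 2)"
    using subset_graph_edge_chromatic_number[of "n - 1"] assms(3) by simp
  moreover have "clique_number (subset_graph {..<n}) = enat (n - 1)"
      "chromatic_number (subset_graph {..<n}) = enat (n - 1)"
    using subset_graph_clique_number_chromatic_number[of n] assms(3) by simp_all
  ultimately show ?thesis
    using iso T by simp
qed

end
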